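(* Let $(\mathfrak g,\delta)$ be a quasi-triangular Lie bialgebra with a family $\mathbf r=\{r^{(c)}\}_{c\in C}$ of classical r-matrices corresponding to $\delta$. Then for $n\ge2$ and $\mathbf c:\{(i,j):1\le i<j\le n\}\to C$ transitive, the diagonal map $\Delta^{(n)}:\mathfrak g\to\mathfrak g^{\oplus n}$, $x\mapsto(x,\dots,x)$, is a homomorphism of Lie bialgebras $(\mathfrak g,\delta)\to(\mathfrak g^{\oplus n},\tilde\delta_{\mathbf c})$, where $\tilde\delta_{\mathbf c}$ is the standard cobracket $\delta_{\mathfrak g^{\oplus n}}$ on $\mathfrak g^{\oplus n}$ twisted by $j_{\mathbf c}(\mathbf r)=\sum_{1\le i<j\le n}(r^{(\mathbf c(i,j))})_{j,n+i}$, that is, $$\tilde\delta_{\mathbf c}(x)=\delta_{\mathfrak g^{\oplus n}}(x)+[\,j_{\mathbf c}(\mathbf r)-\tau(j_{\mathbf c}(\mathbf r)),\,x\otimes1+1\otimes x\,],\qquad x\in\mathfrak g^{\oplus n}.$$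
   Context: The base field $\Bbbk$ has characteristic zero. For a Lie algebra $\mathfrak l$, $\Delta$ is the standard comultiplication of $U(\mathfrak l)$ and $\mathfrak l\otimes\mathfrak l\subset U(\mathfrak l)\otimes U(\mathfrak l)$; $\tau_{i,j}$ swaps tensor factors $i$ and $j$. For $x=\sum_t a_t\otimes b_t\in\mathfrak l\otimes\mathfrak l$ and distinct $i,j$, $x_{i,j}\in U(\mathfrak l)^{\otimes m}$ has $a_t$ in position $i$, $b_t$ in position $j$ and $1$ elsewhere (summed over $t$). A Lie cobracket on $\mathfrak l$ is a linear map $\delta:\mathfrak l\to\mathfrak l\otimes\mathfrak l$ with $\delta([x,y])=[\delta(x),\Delta(y)]-[\delta(y),\Delta(x)]$, $\tau_{1,2}\circ\delta=-\delta$ and $(\mathrm{id}+\tau_{1,2}\tau_{2,3}+\tau_{2,3}\tau_{1,2})\circ(\delta\otimes\mathrm{id})\circ\delta=0$. A classical r-matrix for $(\mathfrak l,\delta)$ is $r\in\mathfrak l\otimes\mathfrak l$ with $\delta(x)=[r,\Delta(x)]$ for all $x\in\mathfrak l$ and $[r_{1,2},r_{1,3}]+[r_{1,2},r_{2,3}]+[r_{1,3},r_{2,3}]=0$; $(\mathfrak l,\delta)$ is quasi-triangular if it has one. $U(\mathfrak g^{\oplus n})=U(\mathfrak g)^{\otimes n}$, so $\mathfrak g^{\oplus n}\otimes\mathfrak g^{\oplus n}\subset U(\mathfrak g)^{\otimes2n}$, with positions $1,\dots,n$ for the first factor and $n+1,\dots,2n$ for the second; $\delta_{\mathfrak g^{\oplus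 n}}(x_1,\dots,x_n)=\sum_i\delta(x_i)_{i,n+i}$, and $\tau$ is the flip of the two factors $\mathfrak g^{\oplus n}$. A homomorphism of Lie bialgebras $\varphi:(\mathfrak l,\delta)\to(\mathfrak l',\delta')$ is a Lie algebra homomorphism with $\delta'\circ\varphi=(\varphi\otimes\varphi)\circ\delta$. $\mathbf c$ is transitive if $\mathbf c(i,k)\in\{\mathbf c(i,j),\mathbf c(j,k)\}$ for all $1\le i<j<k\le n$. *)

theory Defs
  imports
    "HOL-Algebra.QuotRing"
    "HOL-Combinatorics.Transposition"
    "HOL-Analysis.Finite_Cartesian_Product"
    "HOL-Library.Function_Algebras"
    "HOL-Library.Numeral_Type"
    "HOL-Library.Poly_Mapping"
begin

section \<open>Lie algebras\<close>

text \<open>A Lie algebra lives on a whole type \<open>'g\<close>; its scalar multiplication and bracket are bundled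
  in a record.\<close>

record ('k, 'g) lie =
  scl :: "'k \<Rightarrow> 'g \<Rightarrow> 'g"
  brk :: "'g \<Rightarrow> 'g \<Rightarrow> 'g"

definition lie_algebra :: "('k::field, 'g::ab_group_add) lie \<Rightarrow> bool" where
  "lie_algebra L \<longleftrightarrow>
     vector_space (scl L) \<and>
     (\<forall>x. Vector_Spaces.linear (scl L) (scl L) (brk L x)) \<and>
     (\<forall>y. Vector_Spaces.linear (scl L) (scl L) (\<lambda>x. brk L x y)) \<and>
     (\<forall>x. brk L x x = 0) \<and>
     (\<forall>x y z. brk L x (brk L y z) + brk L y (brk L z x) + brk L z (brk L x y) = 0)"

definition lie_hom ::
  "('k::field, 'g::ab_group_add) lie \<Rightarrow> ('k, 'h::ab_group_add) lie \<Rightarrow> ('g \<Rightarrow> 'h) \<Rightarrow> bool" where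
  "lie_hom L L' \<phi> \<longleftrightarrow>
     Vector_Spaces.linear (scl L) (scl L') \<phi> \<and> (\<forall>x y. \<phi> (brk L x y) = brk L' (\<phi> x) (\<phi> y))"

text \<open>The direct sum of \<open>n\<close> copies of a Lie algebra, with the copies indexed by a finite type.\<close>

definition lie_power :: "('k, 'g) lie \<Rightarrow> ('k, 'g ^ 'n) lie" where
  "lie_power L =
     \<lparr>scl = (\<lambda>c x. \<chi> i. scl L c (x $ i)), brk = (\<lambda>x y. \<chi> i. brk L (x $ i) (y $ i))\<rparr>"


section \<open>Tensor powers of the universal enveloping algebra\<close>

datatype 'a free_word = Free_Word (letters: "'a list")

instantiation free_word :: (type) monoid_add
begin

definition zero_free_word :: "'a free_word" where
  "0 = Free_Word []"

definition plus_free_word :: "'a free_word \<Rightarrow> 'a free_word \<Rightarrow> 'a free_word" where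
  "u + v = Free_Word (letters u @ letters v)"

instance
  by standard (simp_all add: zero_free_word_def plus_free_word_def)

end

text \<open>With \<open>'g free_word\<close> the free monoid on \<open>'g\<close>, the monoid algebra \<open>'g free_word \<Rightarrow>\<^sub>0 'k\<close> is the
  free unital associative algebra \<open>F\<close> on the set \<open>'g\<close>. The monoid algebra
  \<open>('m \<Rightarrow> 'g free_word) \<Rightarrow>\<^sub>0 'k\<close> is its tensor power \<open>F\<^sup>\<otimes>\<^sup>m\<close> with positions indexed by \<open>'m\<close>: the tuple
  \<open>w\<close> stands for the pure tensor with \<open>w i\<close> in position \<open>i\<close>, and the empty word \<open>0\<close> is the unit \<open>1\<close>
  of \<open>F\<close>. For two and three tensor factors the index types are \<open>2\<close> and \<open>3\<close>, whose elements are
  \<open>1, 2\<close> and \<open>1, 2, 3\<close> (with \<open>2 = 0\<close> resp. \<open>3 = 0\<close>).\<close>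

type_synonym ('k, 'g) free_alg = "'g free_word \<Rightarrow>\<^sub>0 'k"
type_synonym ('k, 'g, 'm) free_alg_pow = "('m \<Rightarrow> 'g free_word) \<Rightarrow>\<^sub>0 'k"

definition lin_ext :: "('a \<Rightarrow> 'b) \<Rightarrow> ('a \<Rightarrow>\<^sub>0 'k::comm_monoid_add) \<Rightarrow> ('b \<Rightarrow>\<^sub>0 'k)" where
  "lin_ext f p = (\<Sum>w\<in>Poly_Mapping.keys p. Poly_Mapping.single (f w) (Poly_Mapping.lookup p w))"

definition gen :: "'g \<Rightarrow> ('k::field, 'g) free_alg" where
  "gen x = Poly_Mapping.single (Free_Word [x]) 1"

definition slot :: "'m \<Rightarrow> ('k::field, 'g) free_alg \<Rightarrow> ('k, 'g, 'm) free_alg_pow" where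
  "slot i = lin_ext (\<lambda>w. (\<lambda>_. 0)(i := w))"

definition type_ring :: "'r::ring_1 ring" where
  "type_ring = \<lparr>carrier = UNIV, monoid.mult = (*), one = 1, zero = 0, add = (+)\<rparr>"

text \<open>\<open>U(L)\<close> is \<open>F\<close> modulo \<open>env_ideal L\<close>: the first two families of relations turn \<open>F\<close> into the
  tensor algebra of the vector space \<open>L\<close>.\<close>

definition env_relations ::
  "('k::field, 'g::ab_group_add) lie \<Rightarrow> ('k, 'g) free_alg set" where
  "env_relations L =
     {gen (x + y) - gen x - gen y | x y. True} \<union>
     {gen (scl L c x) - Poly_Mapping.single 0 c * gen x | c x. True} \<union>
     {gen x * gen y - gen y * gen x - gen (brk L x y) | x y. True}"

definition env_ideal :: "('k::field, 'g::ab_group_add) lie \<Rightarrow> ('k, 'g) free_alg set" where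
  "env_ideal L = Idl\<^bsub>type_ring\<^esub> (env_relations L)"

text \<open>The kernel of the canonical map from \<open>F\<^sup>\<otimes>\<^sup>m\<close> onto \<open>(F/I)\<^sup>\<otimes>\<^sup>m\<close> is the ideal generated by the
  copies of \<open>I\<close> in the individual positions, so \<open>env_pow L\<close> is \<open>U(L)\<^sup>\<otimes>\<^sup>m\<close>; its elements are cosets.\<close>

type_synonym ('k, 'g, 'm) env = "('k, 'g, 'm) free_alg_pow set"

definition env_pow_ideal ::
  "('k::field, 'g::ab_group_add) lie \<Rightarrow> ('k, 'g, 'm) free_alg_pow set" where
  "env_pow_ideal L = Idl\<^bsub>type_ring\<^esub> (\<Union>i. slot i ` env_ideal L)"

definition env_pow :: "('k::field, 'g::ab_group_add) lie \<Rightarrow> ('k, 'g, 'm) env ring" where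
  "env_pow L = type_ring Quot (env_pow_ideal L)"

definition env_class ::
  "('k::field, 'g::ab_group_add) lie \<Rightarrow> ('k, 'g, 'm) free_alg_pow \<Rightarrow> ('k, 'g, 'm) env" where
  "env_class L p = env_pow_ideal L +>\<^bsub>type_ring\<^esub> p"

definition env_scale ::
  "('k::field, 'g::ab_group_add) lie \<Rightarrow> 'k \<Rightarrow> ('k, 'g, 'm) env \<Rightarrow> ('k, 'g, 'm) env" where
  "env_scale L c X = env_class L (Poly_Mapping.single 0 c) \<otimes>\<^bsub>env_pow L\<^esub> X"

text \<open>\<open>elt L i x\<close> has \<open>x\<close> in position \<open>i\<close> and \<open>1\<close> in all other positions.\<close>

definition elt :: "('k::field, 'g::ab_group_add) lie \<Rightarrow> 'm \<Rightarrow> 'g \<Rightarrow> ('k, 'g, 'm) env" where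
  "elt L i x = env_class L (slot i (gen x))"

text \<open>The map induced on cosets by a map \<open>f\<close> of free algebras: if \<open>f\<close> is compatible with the two
  ideals, the classes of the \<open>f p\<close> with \<open>p \<in> X\<close> all coincide and their union is that class.\<close>

definition induced ::
  "('k::field, 'h::ab_group_add) lie \<Rightarrow>
   (('k, 'g, 'l) free_alg_pow \<Rightarrow> ('k, 'h, 'm) free_alg_pow) \<Rightarrow>
   ('k, 'g, 'l) env \<Rightarrow> ('k, 'h, 'm) env" where
  "induced L' f X = (\<Union>p\<in>X. env_class L' (f p))"

text \<open>\<open>legs L i j X\<close> is \<open>X\<^sub>i\<^sub>,\<^sub>j\<close> for distinct \<open>i\<close>, \<open>j\<close>; \<open>swap L i j\<close> is \<open>\<tau>\<^sub>i\<^sub>,\<^sub>j\<close>; and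
  \<open>tensor_map L' \<phi> \<psi>\<close> is \<open>\<phi> \<otimes> \<psi>\<close> for Lie algebra homomorphisms \<open>\<phi>\<close>, \<open>\<psi>\<close> into \<open>L'\<close>, extended to
  the enveloping algebras.\<close>

definition legs ::
  "('k::field, 'g::ab_group_add) lie \<Rightarrow> 'm \<Rightarrow> 'm \<Rightarrow> ('k, 'g, 2) env \<Rightarrow> ('k, 'g, 'm) env" where
  "legs L i j = induced L (lin_ext (\<lambda>w. (\<lambda>_. 0)(i := w 1, j := w 2)))"

definition swap ::
  "('k::field, 'g::ab_group_add) lie \<Rightarrow> 'm \<Rightarrow> 'm \<Rightarrow> ('k, 'g, 'm) env \<Rightarrow> ('k, 'g, 'm) env" where
  "swap L i j = induced L (lin_ext (\<lambda>w. w \<circ> Transposition.transpose i j))"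

definition tensor_map ::
  "('k::field, 'h::ab_group_add) lie \<Rightarrow> ('g \<Rightarrow> 'h) \<Rightarrow> ('g \<Rightarrow> 'h) \<Rightarrow>
   ('k, 'g, 2) env \<Rightarrow> ('k, 'h, 2) env" where
  "tensor_map L' \<phi> \<psi> =
     induced L' (lin_ext (\<lambda>w k. map_free_word (if k = 1 then \<phi> else \<psi>) (w k)))"

definition commutator :: "('a, 'b) ring_scheme \<Rightarrow> 'a \<Rightarrow> 'a \<Rightarrow> 'a" where
  "commutator R a b = a \<otimes>\<^bsub>R\<^esub> b \<ominus>\<^bsub>R\<^esub> b \<otimes>\<^bsub>R\<^esub> a"

text \<open>The comultiplication of \<open>U(L)\<close>, restricted to \<open>L\<close>: \<open>\<Delta>(x) = x \<otimes> 1 + 1 \<otimes> x\<close>.\<close>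

definition comult :: "('k::field, 'g::ab_group_add) lie \<Rightarrow> 'g \<Rightarrow> ('k, 'g, 2) env" where
  "comult L x = elt L 1 x \<oplus>\<^bsub>env_pow L\<^esub> elt L 2 x"

text \<open>\<open>lie_tensor L N a b\<close> is \<open>\<Sum>\<^sub>t a\<^sub>t \<otimes> b\<^sub>t\<close> over \<open>t < N\<close>, and \<open>lie_tensors L\<close> is the subspace
  \<open>L \<otimes> L\<close> of \<open>U(L) \<otimes> U(L)\<close>.\<close>

definition lie_tensor ::
  "('k::field, 'g::ab_group_add) lie \<Rightarrow> nat \<Rightarrow> (nat \<Rightarrow> 'g) \<Rightarrow> (nat \<Rightarrow> 'g) \<Rightarrow> ('k, 'g, 2) env" where
  "lie_tensor L N a b =
     (\<Oplus>\<^bsub>env_pow L\<^esub> t\<in>{..<N}. elt L 1 (a t) \<otimes>\<^bsub>env_pow L\<^esub> elt L 2 (b t))"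

definition lie_tensors :: "('k::field, 'g::ab_group_add) lie \<Rightarrow> ('k, 'g, 2) env set" where
  "lie_tensors L = {lie_tensor L N a b | N a b. True}"


section \<open>Lie bialgebras\<close>

text \<open>\<open>cobracket_id L \<delta> N a b\<close> is the value \<open>\<Sum>\<^sub>t \<delta>(a\<^sub>t) \<otimes> b\<^sub>t\<close> of \<open>\<delta> \<otimes> id\<close> at \<open>\<Sum>\<^sub>t a\<^sub>t \<otimes> b\<^sub>t\<close>.\<close>

definition cobracket_id ::
  "('k::field, 'g::ab_group_add) lie \<Rightarrow> ('g \<Rightarrow> ('k, 'g, 2) env) \<Rightarrow>
   nat \<Rightarrow> (nat \<Rightarrow> 'g) \<Rightarrow> (nat \<Rightarrow> 'g) \<Rightarrow> ('k, 'g, 3) env" where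
  "cobracket_id L \<delta> N a b =
     (\<Oplus>\<^bsub>env_pow L\<^esub> t\<in>{..<N}. legs L 1 2 (\<delta> (a t)) \<otimes>\<^bsub>env_pow L\<^esub> elt L 3 (b t))"

text \<open>In the last clause \<open>\<delta> \<otimes> id\<close> is evaluated on an expansion of \<open>\<delta>(x)\<close> into pure tensors. The
  result does not depend on the expansion, because \<open>L \<otimes> L\<close> embeds into \<open>U(L) \<otimes> U(L)\<close>.\<close>

definition lie_cobracket ::
  "('k::field, 'g::ab_group_add) lie \<Rightarrow> ('g \<Rightarrow> ('k, 'g, 2) env) \<Rightarrow> bool" where
  "lie_cobracket L \<delta> \<longleftrightarrow>
     (\<forall>x. \<delta> x \<in> lie_tensors L) \<and>
     (\<forall>x y. \<delta> (x + y) = \<delta> x \<oplus>\<^bsub>env_pow L\<^esub> \<delta> y) \<and>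
     (\<forall>c x. \<delta> (scl L c x) = env_scale L c (\<delta> x)) \<and>
     (\<forall>x y. \<delta> (brk L x y) =
        commutator (env_pow L) (\<delta> x) (comult L y) \<ominus>\<^bsub>env_pow L\<^esub>
        commutator (env_pow L) (\<delta> y) (comult L x)) \<and>
     (\<forall>x. swap L 1 2 (\<delta> x) = \<ominus>\<^bsub>env_pow L\<^esub> \<delta> x) \<and>
     (\<forall>x N a b. \<delta> x = lie_tensor L N a b \<longrightarrow>
        (let u = cobracket_id L \<delta> N a b in
           u \<oplus>\<^bsub>env_pow L\<^esub> swap L 1 2 (swap L 2 3 u) \<oplus>\<^bsub>env_pow L\<^esub> swap L 2 3 (swap L 1 2 u)
             = \<zero>\<^bsub>env_pow L\<^esub>))"

definition lie_bialgebra ::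
  "('k::field, 'g::ab_group_add) lie \<Rightarrow> ('g \<Rightarrow> ('k, 'g, 2) env) \<Rightarrow> bool" where
  "lie_bialgebra L \<delta> \<longleftrightarrow> lie_algebra L \<and> lie_cobracket L \<delta>"

definition classical_r_matrix ::
  "('k::field, 'g::ab_group_add) lie \<Rightarrow> ('g \<Rightarrow> ('k, 'g, 2) env) \<Rightarrow> ('k, 'g, 2) env \<Rightarrow> bool" where
  "classical_r_matrix L \<delta> r \<longleftrightarrow>
     r \<in> lie_tensors L \<and>
     (\<forall>x. \<delta> x = commutator (env_pow L) r (comult L x)) \<and>
     (let R = (env_pow L :: ('k, 'g, 3) env ring);
          r12 = legs L 1 2 r; r13 = legs L 1 3 r; r23 = legs L 2 3 r
      in commutator R r12 r13 \<oplus>\<^bsub>R\<^esub> commutator R r12 r23 \<oplus>\<^bsub>R\<^esub> commutator R r13 r23 = \<zero>\<^bsub>R\<^esub>)"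

definition quasi_triangular ::
  "('k::field, 'g::ab_group_add) lie \<Rightarrow> ('g \<Rightarrow> ('k, 'g, 2) env) \<Rightarrow> bool" where
  "quasi_triangular L \<delta> \<longleftrightarrow> (\<exists>r. classical_r_matrix L \<delta> r)"

definition lie_bialgebra_hom ::
  "('k::field, 'g::ab_group_add) lie \<Rightarrow> ('g \<Rightarrow> ('k, 'g, 2) env) \<Rightarrow>
   ('k, 'h::ab_group_add) lie \<Rightarrow> ('h \<Rightarrow> ('k, 'h, 2) env) \<Rightarrow> ('g \<Rightarrow> 'h) \<Rightarrow> bool" where
  "lie_bialgebra_hom L \<delta> L' \<delta>' \<phi> \<longleftrightarrow>
     lie_bialgebra L \<delta> \<and> lie_bialgebra L' \<delta>' \<and>
     lie_hom L L' \<phi> \<and> (\<forall>x. \<delta>' (\<phi> x) = tensor_map L' \<phi> \<phi> (\<delta> x))"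

text \<open>The twist of the cobracket \<open>\<delta>\<close> by \<open>J\<close>, \<open>x \<mapsto> \<delta>(x) + [J - \<tau>(J), x \<otimes> 1 + 1 \<otimes> x]\<close>; for arbitrary \<open>J\<close> it need not
  be a cobracket.\<close>

definition twisted_cobracket ::
  "('k::field, 'g::ab_group_add) lie \<Rightarrow> ('g \<Rightarrow> ('k, 'g, 2) env) \<Rightarrow> ('k, 'g, 2) env \<Rightarrow>
   'g \<Rightarrow> ('k, 'g, 2) env" where
  "twisted_cobracket L \<delta> J x =
     \<delta> x \<oplus>\<^bsub>env_pow L\<^esub> commutator (env_pow L) (J \<ominus>\<^bsub>env_pow L\<^esub> swap L 1 2 J) (comult L x)"


section \<open>Direct sums of copies of a Lie bialgebra\<close>

text \<open>Under \<open>U(L\<^sup>\<oplus>\<^sup>n) = U(L)\<^sup>\<otimes>\<^sup>n\<close>, an element \<open>a\<close> of \<open>L\<close> in position \<open>i\<close> is the vector \<open>axis i a\<close>. Hence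
  \<open>place L i j X\<close>, an element of the second tensor power of \<open>U(L\<^sup>\<oplus>\<^sup>n)\<close>, is the element \<open>X\<^sub>i\<^sub>,\<^sub>n\<^sub>+\<^sub>j\<close> of
  \<open>U(L)\<^sup>\<otimes>\<^sup>2\<^sup>n\<close>.\<close>

definition place ::
  "('k::field, 'g::ab_group_add) lie \<Rightarrow> 'n \<Rightarrow> 'n \<Rightarrow> ('k, 'g, 2) env \<Rightarrow> ('k, 'g ^ 'n, 2) env" where
  "place L i j = tensor_map (lie_power L) (axis i) (axis j)"

definition power_cobracket ::
  "('k::field, 'g::ab_group_add) lie \<Rightarrow> ('g \<Rightarrow> ('k, 'g, 2) env) \<Rightarrow>
   'g ^ 'n \<Rightarrow> ('k, 'g ^ 'n, 2) env" where
  "power_cobracket L \<delta> x = (\<Oplus>\<^bsub>env_pow (lie_power L)\<^esub> i\<in>UNIV. place L i i (\<delta> (x $ i)))"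

definition twist_element ::
  "('k::field, 'g::ab_group_add) lie \<Rightarrow> ('c \<Rightarrow> ('k, 'g, 2) env) \<Rightarrow> ('n \<Rightarrow> 'n \<Rightarrow> 'c) \<Rightarrow>
   ('k, 'g ^ 'n::{finite,linorder}, 2) env" where
  "twist_element L r c =
     (\<Oplus>\<^bsub>env_pow (lie_power L)\<^esub> p\<in>{(i, j). i < j}.
        case p of (i, j) \<Rightarrow> place L j i (r (c i j)))"

definition transitive_colouring :: "('n::linorder \<Rightarrow> 'n \<Rightarrow> 'c) \<Rightarrow> bool" where
  "transitive_colouring c \<longleftrightarrow> (\<forall>i j k. i < j \<and> j < k \<longrightarrow> c i k \<in> {c i j, c j k})"

end

theory Submission
  imports Defs "HOL-Analysis.Cartesian_Space"
begin

text \<open>The twisted cobracket is a coboundary \<open>x \<mapsto> [\<rho>, \<Delta>(x)]\<close>, where \<open>\<rho>\<close> has the component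
  \<open>r (c i j)\<close> in position \<open>(j, i)\<close> and \<open>- \<tau>(r (c i j))\<close> in position \<open>(i, j)\<close> for \<open>i < j\<close>, and an arbitrary
  classical r-matrix on the diagonal. All components \<open>\<rho>\<^sub>a\<^sub>b\<close> are r-matrices for \<open>\<delta>\<close>, so they differ by
  invariants, and \<open>\<rho> + \<tau>(\<rho>)\<close> is invariant. The component \<open>(a, b, d)\<close> of the Yang--Baxter expression of
  \<open>\<rho>\<close> involves only \<open>\<rho>\<^sub>a\<^sub>b\<close>, \<open>\<rho>\<^sub>a\<^sub>d\<close> and \<open>\<rho>\<^sub>b\<^sub>d\<close>; transitivity of the colouring says that
  \<open>\<rho>\<^sub>a\<^sub>d = \<rho>\<^sub>b\<^sub>d\<close>, \<open>\<rho>\<^sub>a\<^sub>b = \<rho>\<^sub>a\<^sub>d\<close> or \<open>\<rho>\<^sub>b\<^sub>d = - \<tau>(\<rho>\<^sub>a\<^sub>b)\<close>, and in each case the component reduces to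
  the classical Yang--Baxter equation of a single r-matrix. Hence \<open>\<rho>\<close> is itself a classical
  r-matrix. For a diagonal element \<open>(x, \<dots>, x)\<close> every component of the
  coboundary is \<open>\<delta>(x)\<close>. For a coboundary the map
  \<open>\<delta> \<otimes> id\<close> is given by a commutator in the enveloping algebra, so its independence of the
  chosen expansion does not need the Poincare--Birkhoff--Witt theorem.\<close>

section \<open>Monoid algebras and their ideals\<close>

lemma lin_ext_superset:
  assumes "finite A" "Poly_Mapping.keys p \<subseteq> A"
  shows "lin_ext f p = (\<Sum>w\<in>A. Poly_Mapping.single (f w) (Poly_Mapping.lookup p w))"
  unfolding lin_ext_def
  by (rule sum.mono_neutral_left) (use assms in \<open>auto simp: in_keys_iff\<close>)

lemma lin_ext_single [simp]: "lin_ext f (Poly_Mapping.single w c) = Poly_Mapping.single (f w) c"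
  by (subst lin_ext_superset[of "{w}"]) auto

lemma lin_ext_zero [simp]: "lin_ext f 0 = 0"
  by (simp add: lin_ext_def)

lemma lin_ext_add: "lin_ext f (p + q) = lin_ext f p + lin_ext f q"
proof -
  let ?A = "Poly_Mapping.keys p \<union> Poly_Mapping.keys q"
  have "Poly_Mapping.keys (p + q) \<subseteq> ?A"
    by (rule Poly_Mapping.keys_add)
  then show ?thesis
    by (simp add: lin_ext_superset[of ?A] lookup_add single_add sum.distrib)
qed

lemma lin_ext_minus:
  fixes p q :: "'a \<Rightarrow>\<^sub>0 'k::ab_group_add"
  shows "lin_ext f (p - q) = lin_ext f p - lin_ext f q"
  using lin_ext_add[of f "p - q" q] by (simp add: algebra_simps)

lemma lin_ext_uminus:
  fixes p :: "'a \<Rightarrow>\<^sub>0 'k::ab_group_add"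
  shows "lin_ext f (- p) = - lin_ext f p"
  using lin_ext_minus[of f 0 p] by simp

lemma lin_ext_sum: "lin_ext f (sum g A) = (\<Sum>x\<in>A. lin_ext f (g x))"
  by (induction A rule: infinite_finite_induct) (simp_all add: lin_ext_add)

lemma poly_mapping_sum_single:
  fixes p :: "'a \<Rightarrow>\<^sub>0 'b::comm_monoid_add"
  shows "p = (\<Sum>w\<in>Poly_Mapping.keys p. Poly_Mapping.single w (Poly_Mapping.lookup p w))"
  by (rule poly_mapping_eqI)
    (simp add: lookup_sum lookup_single when_def in_keys_iff)

lemma poly_mapping_single_induct [case_names zero single add]:
  fixes p :: "'a \<Rightarrow>\<^sub>0 'b::comm_monoid_add"
  assumes "P 0" "\<And>w c. P (Poly_Mapping.single w c)" "\<And>p q. P p \<Longrightarrow> P q \<Longrightarrow> P (p + q)"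
  shows "P p"
proof -
  have "P (\<Sum>w\<in>A. Poly_Mapping.single w (Poly_Mapping.lookup p w))" if "finite A" for A
    using that by (induction A) (auto intro: assms)
  then show ?thesis
    using poly_mapping_sum_single[of p] by (metis finite_keys)
qed

text \<open>A monoid homomorphism induces a homomorphism of monoid algebras. Both sides are
  biadditive, so monomials suffice.\<close>

lemma lin_ext_mult:
  fixes p q :: "'a::monoid_add \<Rightarrow>\<^sub>0 'k::ring_1"
  assumes "\<And>u v. f (u + v) = f u + f v"
  shows "lin_ext f (p * q) = lin_ext f p * lin_ext f q"
proof (induction p rule: poly_mapping_single_induct)
  case (single u a)
  show ?case
    by (induction q rule: poly_mapping_single_induct)
      (simp_all add: mult_single assms lin_ext_add distrib_left)
qed (simp_all add: lin_ext_add distrib_right)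

lemma lin_ext_comp: "lin_ext f (lin_ext g p) = lin_ext (\<lambda>w. f (g w)) p"
  by (induction p rule: poly_mapping_single_induct) (simp_all add: lin_ext_add)

section \<open>Two-sided ideals in a ring on a whole type\<close>

lemma ring_type_ring: "ring (type_ring :: 'r::ring_1 ring)"
proof (rule ringI)
  show "abelian_group (type_ring :: 'r ring)"
    by (rule abelian_groupI)
      (auto simp: type_ring_def add.assoc add.commute intro: exI[of _ "- x" for x])
  show "monoid (type_ring :: 'r ring)"
    by (rule monoidI) (auto simp: type_ring_def mult.assoc)
qed (auto simp: type_ring_def distrib_left distrib_right)

lemma a_inv_type_ring: "\<ominus>\<^bsub>type_ring\<^esub> x = - (x :: 'r::ring_1)"
proof -
  interpret ring "type_ring :: 'r ring"
    by (rule ring_type_ring)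
  show ?thesis
    by (rule minus_equality) (auto simp: type_ring_def)
qed

lemma ideal_type_ring_iff:
  fixes I :: "'r::ring_1 set"
  shows "ideal I type_ring \<longleftrightarrow>
    0 \<in> I \<and> (\<forall>x\<in>I. \<forall>y\<in>I. x + y \<in> I) \<and> (\<forall>x\<in>I. \<forall>y. y * x \<in> I \<and> x * y \<in> I)"
    (is "_ \<longleftrightarrow> ?closed")
proof
  assume "ideal I type_ring"
  then interpret ideal I type_ring .
  show ?closed
    using additive_subgroup.a_closed[OF is_additive_subgroup]
      additive_subgroup.zero_closed[OF is_additive_subgroup] I_l_closed I_r_closed
    by (auto simp: type_ring_def)
next
  assume closed: ?closed
  then have "- x \<in> I" if "x \<in> I" for x
    using that by (metis mult_minus1)
  show "ideal I type_ring"
  proof (rule idealI)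
    interpret ring "type_ring :: 'r ring"
      by (rule ring_type_ring)
    show "subgroup I (add_monoid type_ring)"
      using closed \<open>\<And>x. x \<in> I \<Longrightarrow> - x \<in> I\<close>
      by (intro add.subgroupI) (auto simp: a_inv_type_ring, auto simp: type_ring_def)
  qed (use closed ring_type_ring in \<open>auto simp: type_ring_def\<close>)
qed

lemma ideal_Idl_type_ring: "ideal (Idl\<^bsub>type_ring\<^esub> S) (type_ring :: 'r::ring_1 ring)"
  by (rule ring.genideal_ideal[OF ring_type_ring]) (simp add: type_ring_def)

lemma Idl_type_ring_superset: "S \<subseteq> Idl\<^bsub>type_ring\<^esub> (S :: 'r::ring_1 set)"
  by (rule ring.genideal_self[OF ring_type_ring]) (simp add: type_ring_def)

text \<open>The preimage of \<open>J\<close> is an ideal containing \<open>S\<close>, hence contains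
  the ideal generated by \<open>S\<close>.\<close>

lemma Idl_type_ring_hom:
  fixes f :: "'r::ring_1 \<Rightarrow> 's::ring_1"
  assumes add: "\<And>x y. f (x + y) = f x + f y" and mult: "\<And>x y. f (x * y) = f x * f y"
    and J: "ideal J type_ring" and S: "\<And>x. x \<in> S \<Longrightarrow> f x \<in> J" and x: "x \<in> Idl\<^bsub>type_ring\<^esub> S"
  shows "f x \<in> J"
proof -
  have "f 0 = 0"
    using add[of 0 0] by simp
  then have "ideal (f -` J) type_ring"
    using J by (auto simp: ideal_type_ring_iff add mult)
  then have "Idl\<^bsub>type_ring\<^esub> S \<subseteq> f -` J"
    by (rule ring.genideal_minimal[OF ring_type_ring]) (use S in auto)
  with x show ?thesis
    by auto
qed

lemma ideal_env_pow_ideal: "ideal (env_pow_ideal L) type_ring"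
  unfolding env_pow_ideal_def by (rule ideal_Idl_type_ring)

lemmas ideal_type_ringD = ideal_type_ring_iff[THEN iffD1]

lemma env_pow_ideal_zero [simp]: "0 \<in> env_pow_ideal L"
  by (rule ideal_type_ringD[OF ideal_env_pow_ideal, THEN conjunct1])

lemma env_pow_ideal_add: "p \<in> env_pow_ideal L \<Longrightarrow> q \<in> env_pow_ideal L \<Longrightarrow> p + q \<in> env_pow_ideal L"
  by (rule ideal_type_ringD[OF ideal_env_pow_ideal, THEN conjunct2, THEN conjunct1, rule_format])

lemma env_pow_ideal_mult_left: "p \<in> env_pow_ideal L \<Longrightarrow> q * p \<in> env_pow_ideal L"
  and env_pow_ideal_mult_right: "p \<in> env_pow_ideal L \<Longrightarrow> p * q \<in> env_pow_ideal L"
  using ideal_type_ringD[OF ideal_env_pow_ideal, THEN conjunct2, THEN conjunct2, rule_format]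
  by blast+

lemma env_pow_ideal_uminus: "p \<in> env_pow_ideal L \<Longrightarrow> - p \<in> env_pow_ideal L"
  using env_pow_ideal_mult_left[of p L "-1"] by simp

lemma env_pow_ideal_diff:
  "p \<in> env_pow_ideal L \<Longrightarrow> q \<in> env_pow_ideal L \<Longrightarrow> p - q \<in> env_pow_ideal L"
  using env_pow_ideal_add[OF _ env_pow_ideal_uminus] by fastforce

lemma env_pow_ideal_sum:
  "(\<And>x. x \<in> A \<Longrightarrow> f x \<in> env_pow_ideal L) \<Longrightarrow> sum f A \<in> env_pow_ideal L"
  by (induction A rule: infinite_finite_induct) (auto intro: env_pow_ideal_add)

text \<open>The counterpart of \<open>commutator\<close> on representatives, where the usual ring
  simplification is available. Identities are computed in the free algebra and only then passed to
  cosets.\<close>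

definition comm :: "'r::ring_1 \<Rightarrow> 'r \<Rightarrow> 'r" where
  "comm x y = x * y - y * x"

lemma comm_add_left: "comm (x + y) z = comm x z + comm y z"
  and comm_add_right: "comm z (x + y) = comm z x + comm z y"
  and comm_diff_left: "comm (x - y) z = comm x z - comm y z"
  and comm_diff_right: "comm z (x - y) = comm z x - comm z y"
  and comm_uminus_left: "comm (- x) z = - comm x z"
  and comm_zero_left [simp]: "comm 0 z = 0"
  and comm_zero_right [simp]: "comm z 0 = 0"
  and comm_mult_left: "comm (x * y) z = x * comm y z + comm x z * y"
  and comm_mult_right: "comm z (x * y) = x * comm z y + comm z x * y"
  and comm_swap: "comm y x = - comm x y"
  by (simp_all add: comm_def algebra_simps)

lemma comm_sum_left: "comm (sum f A) z = (\<Sum>x\<in>A. comm (f x) z)"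
  and comm_sum_right: "comm z (sum f A) = (\<Sum>x\<in>A. comm z (f x))"
  by (simp_all add: comm_def sum_distrib_left sum_distrib_right sum_subtractf)

lemma lin_ext_comm:
  fixes p q :: "'a::monoid_add \<Rightarrow>\<^sub>0 'k::ring_1"
  assumes "\<And>u v. f (u + v) = f u + f v"
  shows "lin_ext f (comm p q) = comm (lin_ext f p) (lin_ext f q)"
  by (simp add: comm_def lin_ext_mult lin_ext_minus assms)

lemma comm_in_ideal_left: "p \<in> env_pow_ideal L \<Longrightarrow> comm p q \<in> env_pow_ideal L"
  and comm_in_ideal_right: "p \<in> env_pow_ideal L \<Longrightarrow> comm q p \<in> env_pow_ideal L"
  by (simp_all add: comm_def env_pow_ideal_diff env_pow_ideal_mult_left env_pow_ideal_mult_right)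


section \<open>Classes in tensor powers of the enveloping algebra\<close>

lemma ring_hom_env_class: "ring_hom_ring type_ring (env_pow L) (env_class L)"
  unfolding env_pow_def env_class_def[abs_def]
  by (rule ideal.rcos_ring_hom_ring[OF ideal_env_pow_ideal])

lemma env_class_carrier [simp]: "env_class L p \<in> carrier (env_pow L)"
  using ring_hom_ring.homh[OF ring_hom_env_class, THEN ring_hom_closed] by (simp add: type_ring_def)

lemma ring_env_pow: "ring (env_pow L)"
  using ring_hom_env_class by (rule ring_hom_ring.axioms)

lemma env_class_mult: "env_class L p \<otimes>\<^bsub>env_pow L\<^esub> env_class L q = env_class L (p * q)"
  using ring_hom_mult[OF ring_hom_ring.homh[OF ring_hom_env_class], of p q]
  by (simp add: type_ring_def)

lemma env_class_add: "env_class L p \<oplus>\<^bsub>env_pow L\<^esub> env_class L q = env_class L (p + q)"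
  using ring_hom_add[OF ring_hom_ring.homh[OF ring_hom_env_class], of p q]
  by (simp add: type_ring_def)

lemma env_class_zero: "\<zero>\<^bsub>env_pow L\<^esub> = env_class L 0"
  by (rule ring_hom_zero[OF ring_hom_ring.homh[OF ring_hom_env_class] ring_type_ring ring_env_pow,
        unfolded type_ring_def ring.simps, symmetric])

lemma env_class_uminus: "\<ominus>\<^bsub>env_pow L\<^esub> env_class L p = env_class L (- p)"
proof -
  interpret ring "env_pow L"
    by (rule ring_env_pow)
  show ?thesis
    by (rule minus_equality) (simp_all add: env_class_add env_class_zero)
qed

lemma env_class_diff: "env_class L p \<ominus>\<^bsub>env_pow L\<^esub> env_class L q = env_class L (p - q)"
  by (simp add: a_minus_def env_class_uminus env_class_add)

lemma env_class_commutator: "commutator (env_pow L) (env_class L p) (env_class L q) = env_class L (comm p q)"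
  by (simp add: commutator_def comm_def env_class_mult env_class_diff)

lemma env_class_finsum:
  assumes "finite A"
  shows "(\<Oplus>\<^bsub>env_pow L\<^esub> x\<in>A. env_class L (f x)) = env_class L (sum f A)"
proof -
  interpret ring "env_pow L"
    by (rule ring_env_pow)
  show ?thesis
    using assms by (induction A) (simp_all add: env_class_zero env_class_add)
qed

text \<open>The bridge between the two levels: an equation between cosets becomes membership of a
  difference of representatives in the ideal.\<close>

lemma env_class_eq_iff:
  fixes p q :: "('k::field, 'g::ab_group_add, 'm) free_alg_pow"
  shows "env_class L p = env_class L q \<longleftrightarrow> p - q \<in> env_pow_ideal L"
proof
  have coset: "env_class L p = {h + p | h. h \<in> env_pow_ideal L}"
    for p :: "('k, 'g, 'm) free_alg_pow"
    by (auto simp: env_class_def a_r_coset_def r_coset_def type_ring_def)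
  show "p - q \<in> env_pow_ideal L" if "env_class L p = env_class L q"
  proof -
    have "0 + p \<in> env_class L p"
      using env_pow_ideal_zero by (fastforce simp: coset)
    then show ?thesis
      unfolding that by (auto simp: coset)
  qed
  show "env_class L p = env_class L q" if pq: "p - q \<in> env_pow_ideal L"
  proof -
    have "{h + p | h. h \<in> env_pow_ideal L} \<subseteq> {h + q | h. h \<in> env_pow_ideal L}"
      if "p - q \<in> env_pow_ideal L" for p q :: "('k, 'g, 'm) free_alg_pow"
    proof clarify
      fix h :: "('k, 'g, 'm) free_alg_pow"
      assume "h \<in> env_pow_ideal L"
      with that have "h + (p - q) \<in> env_pow_ideal L"
        by (rule env_pow_ideal_add[rotated])
      then show "\<exists>h'. h + p = h' + q \<and> h' \<in> env_pow_ideal L"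
        by (intro exI[of _ "h + (p - q)"]) simp
    qed
    from this[OF pq] this[of q p] show ?thesis
      using env_pow_ideal_uminus[OF pq] by (simp add: coset)
  qed
qed

lemma env_class_mem: "p \<in> env_class L p"
  using env_pow_ideal_zero
  by (fastforce simp: env_class_def a_r_coset_def r_coset_def type_ring_def)

lemma env_class_memD: "q \<in> env_class L p \<Longrightarrow> q - p \<in> env_pow_ideal L"
  by (auto simp: env_class_def a_r_coset_def r_coset_def type_ring_def)

text \<open>All representatives of a coset have images in one class, so the union defining
  \<open>induced\<close> collapses to that class.\<close>

lemma induced_env_class:
  assumes "\<And>p. p \<in> env_pow_ideal L \<Longrightarrow> lin_ext f p \<in> env_pow_ideal L'"
  shows "induced L' (lin_ext f) (env_class L p) = env_class L' (lin_ext f p)"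
proof -
  have "env_class L' (lin_ext f q) = env_class L' (lin_ext f p)" if "q \<in> env_class L p" for q
    using assms[OF env_class_memD[OF that]] by (simp add: env_class_eq_iff lin_ext_minus)
  then show ?thesis
    unfolding induced_def using env_class_mem[of p L] by blast
qed

section \<open>Letters\<close>

definition letter :: "'m \<Rightarrow> 'g \<Rightarrow> ('k::field, 'g, 'm) free_alg_pow" where
  "letter i x = slot i (gen x)"

lemma letter_eq: "letter i x = Poly_Mapping.single ((\<lambda>_. 0)(i := Free_Word [x])) 1"
  by (simp add: letter_def slot_def gen_def)

lemma elt_eq: "elt L i x = env_class L (letter i x)"
  by (simp add: elt_def letter_def)

text \<open>Words supported in different positions commute already in the monoid of tuples, so the
  equality is exact and not only modulo the ideal.\<close>

lemma comm_letter: "i \<noteq> j \<Longrightarrow> comm (letter i x) (letter j y) = 0"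
proof -
  assume "i \<noteq> j"
  then have "(\<lambda>_. 0)(i := Free_Word [x]) + (\<lambda>_. 0)(j := Free_Word [y]) =
    (\<lambda>_. 0)(j := Free_Word [y]) + (\<lambda>_. 0)(i := Free_Word [x])"
    by (auto simp: fun_eq_iff)
  then show ?thesis
    by (simp add: comm_def letter_eq mult_single)
qed

lemma slot_word_add: "(\<lambda>_. 0)(i := u + v) = (\<lambda>_. 0 :: 'a free_word)(i := u) + (\<lambda>_. 0)(i := v)"
  by (auto simp: fun_eq_iff)

lemma slot_mult: "slot i (p * q) = slot i p * slot i q"
  unfolding slot_def by (rule lin_ext_mult) (rule slot_word_add)

lemma slot_add: "slot i (p + q) = slot i p + slot i q"
  and slot_minus: "slot i (p - q) = slot i p - slot i q"
  by (simp_all add: slot_def lin_ext_add lin_ext_minus)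

lemma slot_const: "slot i (Poly_Mapping.single 0 c) = Poly_Mapping.single 0 c"
  by (simp add: slot_def) (metis fun_upd_triv zero_fun_def)

lemma slot_env_relation:
  assumes "q \<in> env_relations L"
  shows "slot i q \<in> env_pow_ideal L"
proof -
  have "q \<in> env_ideal L"
    using assms Idl_type_ring_superset unfolding env_ideal_def by blast
  then show ?thesis
    unfolding env_pow_ideal_def by (intro subsetD[OF Idl_type_ring_superset]) auto
qed

lemma letter_add: "letter i (x + y) - letter i x - letter i y \<in> env_pow_ideal L"
proof -
  have "slot i (gen (x + y) - gen x - gen y) \<in> env_pow_ideal L"
    by (rule slot_env_relation) (auto simp: env_relations_def)
  then show ?thesis
    by (simp add: slot_minus letter_def)
qed

lemma letter_scl: "letter i (scl L c x) - Poly_Mapping.single 0 c * letter i x \<in> env_pow_ideal L"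
proof -
  have "slot i (gen (scl L c x) - Poly_Mapping.single 0 c * gen x) \<in> env_pow_ideal L"
    by (rule slot_env_relation) (auto simp: env_relations_def)
  then show ?thesis
    by (simp add: slot_minus slot_mult slot_const letter_def)
qed

lemma letter_brk: "comm (letter i x) (letter i y) - letter i (brk L x y) \<in> env_pow_ideal L"
proof -
  have "slot i (gen x * gen y - gen y * gen x - gen (brk L x y)) \<in> env_pow_ideal L"
    by (rule slot_env_relation) (auto simp: env_relations_def)
  then show ?thesis
    by (simp add: slot_minus slot_mult letter_def comm_def)
qed

lemma letter_zero: "letter i 0 \<in> env_pow_ideal L"
  using env_pow_ideal_uminus[OF letter_add[of i 0 0 L]] by simp

lemma letter_uminus: "letter i (- x) + letter i x \<in> env_pow_ideal L"
proof -
  have "letter i (- x) + letter i x = letter i (x + - x) - (letter i (x + - x) - letter i x - letter i (- x))"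
    by simp
  also have "\<dots> \<in> env_pow_ideal L"
    by (rule env_pow_ideal_diff) (use letter_add[of i x "- x"] letter_zero in auto)
  finally show ?thesis .
qed

lemma letter_sum: "letter i (sum f A) - (\<Sum>x\<in>A. letter i (f x)) \<in> env_pow_ideal L"
proof (induction A rule: infinite_finite_induct)
  case (insert a A)
  have "letter i (sum f (insert a A)) - (\<Sum>x\<in>insert a A. letter i (f x)) =
    (letter i (f a + sum f A) - letter i (f a) - letter i (sum f A)) +
    (letter i (sum f A) - (\<Sum>x\<in>A. letter i (f x)))"
    using insert by (simp add: algebra_simps)
  also have "\<dots> \<in> env_pow_ideal L"
    by (intro env_pow_ideal_add letter_add insert.IH)
  finally show ?case .
qed (auto simp: letter_zero)

text \<open>Homomorphisms of this kind descend to the enveloping algebras.\<close>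

definition word_hom ::
  "('k::field, 'g::ab_group_add) lie \<Rightarrow> ('k, 'h::ab_group_add) lie \<Rightarrow>
   (('l \<Rightarrow> 'g free_word) \<Rightarrow> 'm \<Rightarrow> 'h free_word) \<Rightarrow> ('l \<Rightarrow> 'm) \<Rightarrow> ('l \<Rightarrow> 'g \<Rightarrow> 'h) \<Rightarrow> bool" where
  "word_hom L L' f \<sigma> \<phi> \<longleftrightarrow>
     (\<forall>u v. f (u + v) = f u + f v) \<and>
     (\<forall>i x. f ((\<lambda>_. 0)(i := Free_Word [x])) = (\<lambda>_. 0)(\<sigma> i := Free_Word [\<phi> i x])) \<and>
     (\<forall>i. lie_hom L L' (\<phi> i))"

context
  fixes L :: "('k::field, 'g::ab_group_add) lie" and L' :: "('k, 'h::ab_group_add) lie"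
    and f :: "('l \<Rightarrow> 'g free_word) \<Rightarrow> 'm \<Rightarrow> 'h free_word" and \<sigma> \<phi>
  assumes hom: "word_hom L L' f \<sigma> \<phi>"
begin

lemma word_hom_add: "f (u + v) = f u + f v"
  using hom by (simp add: word_hom_def)

lemma word_hom_zero: "f 0 = 0"
proof -
  \<comment> \<open>A word \<open>w\<close> with \<open>w = w + w\<close> is empty, by comparing the
    underlying lists.\<close>
  have "f 0 i = 0" for i
    using fun_cong[OF word_hom_add[of 0 0], of i]
    by (cases "f 0 i") (simp add: plus_free_word_def zero_free_word_def)
  then show ?thesis
    by (simp add: fun_eq_iff)
qed

lemma word_hom_letter: "lin_ext f (letter i x) = letter (\<sigma> i) (\<phi> i x)"
  using hom by (simp add: word_hom_def letter_eq)

lemma word_hom_mult: "lin_ext f (p * q) = lin_ext f p * lin_ext f (q :: ('k, 'g, 'l) free_alg_pow)"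
  by (rule lin_ext_mult) (rule word_hom_add)

lemma word_hom_slot_relation:
  assumes "q \<in> env_relations L"
  shows "lin_ext f (slot i q) \<in> env_pow_ideal L'"
proof -
  have hom_i: "lie_hom L L' (\<phi> i)"
    using hom by (simp add: word_hom_def)
  then have linear: "\<phi> i (x + y) = \<phi> i x + \<phi> i y" "\<phi> i (scl L c x) = scl L' c (\<phi> i x)"
    and brk: "\<phi> i (brk L x y) = brk L' (\<phi> i x) (\<phi> i y)" for x y c
    by (auto simp: lie_hom_def Vector_Spaces.linear_iff)
  have const: "lin_ext f (slot i (Poly_Mapping.single 0 c)) = Poly_Mapping.single 0 c" for c :: 'k
    by (simp add: slot_const word_hom_zero)
  from assms show ?thesis
    unfolding env_relations_def
    using letter_add letter_scl letter_brk
    by (auto simp: slot_minus slot_mult lin_ext_minus word_hom_mult const word_hom_letter linear brk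
        comm_def simp flip: letter_def)
qed

text \<open>The ideal is generated in two stages, so \<open>Idl_type_ring_hom\<close> is applied
  twice: to the relations inside one position, then to the union over all positions.\<close>

lemma word_hom_ideal: "p \<in> env_pow_ideal L \<Longrightarrow> lin_ext f p \<in> env_pow_ideal L'"
proof -
  assume p: "p \<in> env_pow_ideal L"
  have slot: "lin_ext f (slot i q) \<in> env_pow_ideal L'" if "q \<in> env_ideal L" for i q
  proof (rule Idl_type_ring_hom[where f = "\<lambda>q. lin_ext f (slot i q)"])
    show "q \<in> Idl\<^bsub>type_ring\<^esub> (env_relations L)"
      using that by (simp add: env_ideal_def)
  qed (simp_all add: slot_add slot_mult lin_ext_add word_hom_mult ideal_env_pow_ideal
      word_hom_slot_relation)
  show ?thesis
  proof (rule Idl_type_ring_hom[where f = "lin_ext f"])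
    show "p \<in> Idl\<^bsub>type_ring\<^esub> (\<Union>i. slot i ` env_ideal L)"
      using p by (simp add: env_pow_ideal_def)
    show "lin_ext f x \<in> env_pow_ideal L'" if "x \<in> (\<Union>i. slot i ` env_ideal L)" for x
      using that slot by blast
  qed (rule lin_ext_add word_hom_mult ideal_env_pow_ideal)+
qed

lemma word_hom_induced: "induced L' (lin_ext f) (env_class L p) = env_class L' (lin_ext f p)"
  by (rule induced_env_class) (rule word_hom_ideal)

end

lemma lie_hom_id: "lie_algebra L \<Longrightarrow> lie_hom L L (\<lambda>x. x)"
  unfolding lie_hom_def lie_algebra_def
  by (simp add: Vector_Spaces.linear_iff vector_space_def)

section \<open>Tensors of Lie algebra elements\<close>

definition coproduct :: "'g \<Rightarrow> ('k::field, 'g, 2) free_alg_pow" where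
  "coproduct x = letter 1 x + letter 2 x"

lemma comult_eq: "comult L x = env_class L (coproduct x)"
  by (simp add: comult_def elt_eq env_class_add coproduct_def)

abbreviation pure :: "'g \<Rightarrow> 'g \<Rightarrow> ('k::field, 'g, 2) free_alg_pow" where
  "pure x y \<equiv> letter 1 x * letter 2 y"

text \<open>Representatives of the elements of \<open>lie_tensors L\<close>. The rule
  \<open>cong\<close> makes this a property of the class, and the induction rule reduces additive
  statements to pure tensors.\<close>

inductive tensor_rep :: "('k::field, 'g::ab_group_add) lie \<Rightarrow> ('k, 'g, 2) free_alg_pow \<Rightarrow> bool"
  for L where
  zero: "tensor_rep L 0"
| add_pure: "tensor_rep L p \<Longrightarrow> tensor_rep L (p + pure x y)"
| cong: "tensor_rep L p \<Longrightarrow> p - q \<in> env_pow_ideal L \<Longrightarrow> tensor_rep L q"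

lemma lie_tensor_eq: "lie_tensor L N a b = env_class L (\<Sum>t<(N::nat). pure (a t) (b t))"
  by (simp add: lie_tensor_def elt_eq env_class_mult env_class_finsum)

lemma tensor_rep_sum_pure: "tensor_rep L (\<Sum>t<(N::nat). pure (a t) (b t))"
  by (induction N) (simp_all add: tensor_rep.zero tensor_rep.add_pure)

lemma tensor_rep_imp_sum:
  assumes "tensor_rep L p"
  shows "\<exists>N a b. p - (\<Sum>t<(N::nat). pure (a t) (b t)) \<in> env_pow_ideal L"
  using assms
proof (induction rule: tensor_rep.induct)
  case zero
  have "0 - (\<Sum>t<(0::nat). pure (a t) (b t)) \<in> env_pow_ideal L" for a b :: "nat \<Rightarrow> 'b"
    by simp
  then show ?case
    by blast
next
  case (add_pure p x y)
  then obtain N a b where "p - (\<Sum>t<(N::nat). pure (a t) (b t)) \<in> env_pow_ideal L"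
    by blast
  \<comment> \<open>The index \<open>N\<close> lies just outside the old range, so the new pure
    tensor can be stored there without changing the old sum.\<close>
  moreover have "(\<Sum>t<(N::nat). pure ((a(N := x)) t) ((b(N := y)) t)) =
    (\<Sum>t<(N::nat). pure (a t) (b t) :: ('a, 'b, 2) free_alg_pow)"
    by (rule sum.cong) auto
  ultimately have "p + pure x y -
    (\<Sum>t<Suc N. pure ((a(N := x)) t) ((b(N := y)) t)) \<in> env_pow_ideal L"
    by simp
  then show ?case
    by blast
next
  case (cong p q)
  then obtain N a b where "p - (\<Sum>t<(N::nat). pure (a t) (b t)) \<in> env_pow_ideal L"
    by blast
  from env_pow_ideal_diff[OF this cong.hyps(2)] show ?case
    by auto
qed

lemma tensor_rep_iff: "env_class L p \<in> lie_tensors L \<longleftrightarrow> tensor_rep L p"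
proof
  assume "env_class L p \<in> lie_tensors L"
  then obtain N a b where "env_class L p = lie_tensor L N a b"
    by (auto simp: lie_tensors_def)
  then have "env_class L (\<Sum>t<(N::nat). pure (a t) (b t)) = env_class L p"
    by (simp add: lie_tensor_eq)
  then show "tensor_rep L p"
    by (intro tensor_rep.cong[OF tensor_rep_sum_pure]) (simp add: env_class_eq_iff)
next
  assume "tensor_rep L p"
  then obtain N a b where "p - (\<Sum>t<(N::nat). pure (a t) (b t)) \<in> env_pow_ideal L"
    using tensor_rep_imp_sum by blast
  then have "env_class L p = lie_tensor L N a b"
    by (simp add: lie_tensor_eq env_class_eq_iff)
  then show "env_class L p \<in> lie_tensors L"
    by (auto simp: lie_tensors_def)
qed

lemma lie_tensorsE:
  assumes "X \<in> lie_tensors L"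
  obtains p where "X = env_class L p" "tensor_rep L p"
proof -
  from assms obtain N a b where "X = lie_tensor L N a b"
    by (auto simp: lie_tensors_def)
  then show ?thesis
    by (intro that[OF _ tensor_rep_sum_pure]) (simp add: lie_tensor_eq)
qed

lemma tensor_rep_add:
  assumes "tensor_rep L p" "tensor_rep L q"
  shows "tensor_rep L (p + q)"
  using assms(2)
proof (induction rule: tensor_rep.induct)
  case zero
  show ?case
    using assms(1) by simp
next
  case (add_pure q x y)
  then show ?case
    using tensor_rep.add_pure[of L "p + q" x y] by (simp add: add.assoc)
next
  case (cong q q')
  then show ?case
    using tensor_rep.cong[of L "p + q" "p + q'"] by simp
qed

lemma tensor_rep_pure: "tensor_rep L (pure x y)"
  using tensor_rep.add_pure[OF tensor_rep.zero] by simp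

lemma tensor_rep_sum: "(\<And>x. x \<in> A \<Longrightarrow> tensor_rep L (f x)) \<Longrightarrow> tensor_rep L (sum f A)"
  by (induction A rule: infinite_finite_induct) (auto intro: tensor_rep_add tensor_rep.zero)

text \<open>Together with \<open>tensor_rep_kernel\<close>, this is the device by which additive
  maps compatible with the ideals are checked on pure tensors only.\<close>

lemma tensor_rep_map:
  assumes add: "\<And>p q. F (p + q) = F p + F q"
    and ideal: "\<And>p. p \<in> env_pow_ideal L \<Longrightarrow> F p \<in> env_pow_ideal L'"
    and pure: "\<And>x y. tensor_rep L' (F (pure x y))"
    and p: "tensor_rep L p"
  shows "tensor_rep L' (F p)"
  using p
proof (induction rule: tensor_rep.induct)
  case zero
  then show ?case
    using add[of 0 0] by (simp add: tensor_rep.zero)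
next
  case (add_pure p x y)
  then show ?case
    by (simp add: add tensor_rep_add pure)
next
  case (cong p q)
  then show ?case
    using ideal[of "p - q"] add[of "p - q" q] tensor_rep.cong[of L' "F p" "F q"] by simp
qed

lemma tensor_rep_kernel:
  assumes add: "\<And>p q. F (p + q) = F p + F q"
    and ideal: "\<And>p. p \<in> env_pow_ideal L \<Longrightarrow> F p \<in> env_pow_ideal L'"
    and pure: "\<And>x y. F (pure x y) \<in> env_pow_ideal L'"
    and p: "tensor_rep L p"
  shows "F p \<in> env_pow_ideal L'"
  using p
proof (induction rule: tensor_rep.induct)
  case zero
  then show ?case
    using add[of 0 0] by simp
next
  case (add_pure p x y)
  then show ?case
    by (simp add: add env_pow_ideal_add pure)
next
  case (cong p q)
  then show ?case
    using env_pow_ideal_diff[of "F p" L' "F (p - q)"] ideal[of "p - q"] add[of "p - q" q] by simp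
qed

text \<open>The sign of a pure tensor can be absorbed into its first factor modulo the
  ideal.\<close>

lemma tensor_rep_uminus: "tensor_rep L p \<Longrightarrow> tensor_rep L (- p)"
proof (rule tensor_rep_map[of uminus L L])
  fix x y :: 'b
  have "letter 1 (- x) * letter 2 y - - (pure x y) =
    (letter 1 (- x) + letter 1 x) * (letter 2 y :: ('a, 'b, 2) free_alg_pow)"
    by (simp add: algebra_simps)
  also have "\<dots> \<in> env_pow_ideal L"
    by (rule env_pow_ideal_mult_right) (rule letter_uminus)
  finally show "tensor_rep L (- (pure x y))"
    by (rule tensor_rep.cong[OF tensor_rep_pure])
qed (auto simp: env_pow_ideal_uminus)

lemma tensor_rep_diff: "tensor_rep L p \<Longrightarrow> tensor_rep L q \<Longrightarrow> tensor_rep L (p - q)"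
  using tensor_rep_add[OF _ tensor_rep_uminus] by fastforce

text \<open>On a pure tensor, bracketing with \<open>coproduct z\<close> gives \<open>[x,z]\<close>
  tensor \<open>y\<close> plus \<open>x\<close> tensor \<open>[y,z]\<close> modulo the ideal, which
  is again a sum of pure tensors.\<close>

lemma tensor_rep_comm_coproduct:
  assumes "tensor_rep L p"
  shows "tensor_rep L (comm p (coproduct z))"
proof (rule tensor_rep_map[of "\<lambda>p. comm p (coproduct z)", OF _ _ _ assms])
  fix x y
  let ?c = "letter 1 (brk L x z) * letter 2 y + letter 1 x * letter 2 (brk L y z)"
  have "?c - comm (pure x y) (coproduct z) =
    - (letter 1 x * (comm (letter 2 y) (letter 2 z) - letter 2 (brk L y z)) +
       (comm (letter 1 x) (letter 1 z) - letter 1 (brk L x z)) * letter 2 y)"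
    by (simp add: coproduct_def comm_mult_left comm_add_right comm_letter algebra_simps)
  also have "\<dots> \<in> env_pow_ideal L"
    by (intro env_pow_ideal_uminus env_pow_ideal_add env_pow_ideal_mult_left
        env_pow_ideal_mult_right letter_brk)
  finally show "tensor_rep L (comm (pure x y) (coproduct z))"
    by (rule tensor_rep.cong[rotated]) (intro tensor_rep_add tensor_rep_pure)
qed (simp_all add: comm_add_left comm_in_ideal_left)


section \<open>Legs, flips and the classical Yang--Baxter equation\<close>

definition leg :: "'m \<Rightarrow> 'm \<Rightarrow> ('k::field, 'g, 2) free_alg_pow \<Rightarrow> ('k, 'g, 'm) free_alg_pow" where
  "leg i j = lin_ext (\<lambda>w. (\<lambda>_. 0)(i := w 1, j := w 2))"

definition flip :: "'m \<Rightarrow> 'm \<Rightarrow> ('k::field, 'g, 'm) free_alg_pow \<Rightarrow> ('k, 'g, 'm) free_alg_pow" where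
  "flip i j = lin_ext (\<lambda>w. w \<circ> Transposition.transpose i j)"

lemma leg_add: "leg i j (p + q) = leg i j p + leg i j q"
  and leg_diff: "leg i j (p - q) = leg i j p - leg i j q"
  and leg_uminus: "leg i j (- p) = - leg i j p"
  by (simp_all add: leg_def lin_ext_add lin_ext_minus lin_ext_uminus)

lemma leg_word_add:
  fixes u v :: "2 \<Rightarrow> 'g free_word"
  assumes "i \<noteq> j"
  shows "(\<lambda>_. 0)(i := (u + v) 1, j := (u + v) 2) =
    (\<lambda>_. 0)(i := u 1, j := u 2) + (\<lambda>_. 0)(i := v 1, j := v 2)"
  using assms by (auto simp: fun_eq_iff)

lemma leg_mult: "i \<noteq> j \<Longrightarrow> leg i j (p * q) = leg i j p * leg i j q"
  unfolding leg_def by (intro lin_ext_mult leg_word_add)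

lemma leg_comm: "i \<noteq> j \<Longrightarrow> leg i j (comm p q) = comm (leg i j p) (leg i j q)"
  unfolding leg_def by (intro lin_ext_comm leg_word_add)

lemma flip_mult: "flip i j (p * q) = flip i j p * flip i j q"
  and flip_comm: "flip i j (comm p q) = comm (flip i j p) (flip i j q)"
  unfolding flip_def by (rule lin_ext_mult lin_ext_comm, simp add: fun_eq_iff)+

lemma leg_sum: "leg i j (sum f A) = (\<Sum>x\<in>A. leg i j (f x))"
  by (simp add: leg_def lin_ext_sum)

lemma word_leg:
  assumes "i \<noteq> j" "lie_algebra L"
  shows "word_hom L L (\<lambda>w :: 2 \<Rightarrow> 'g::ab_group_add free_word. (\<lambda>_. 0)(i := w 1, j := w 2)) (\<lambda>k. if k = 1 then i else j) (\<lambda>_ x. x)"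
  using assms exhaust_2 by (force simp: word_hom_def fun_eq_iff lie_hom_id)

lemma leg_ideal:
  "i \<noteq> j \<Longrightarrow> lie_algebra L \<Longrightarrow> p \<in> env_pow_ideal L \<Longrightarrow> leg i j p \<in> env_pow_ideal L"
  unfolding leg_def by (rule word_hom_ideal[OF word_leg])

lemma word_flip:
  "lie_algebra L \<Longrightarrow>
    word_hom L L (\<lambda>w. w \<circ> Transposition.transpose i j) (Transposition.transpose i j) (\<lambda>_ x. x)"
  by (auto simp: word_hom_def fun_eq_iff lie_hom_id Transposition.transpose_def)

lemma flip_ideal: "lie_algebra L \<Longrightarrow> p \<in> env_pow_ideal L \<Longrightarrow> flip i j p \<in> env_pow_ideal L"
  unfolding flip_def by (rule word_hom_ideal[OF word_flip])

lemma leg_letter: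
  assumes "i \<noteq> j"
  shows "leg i j (letter 1 x) = letter i x" "leg i j (letter 2 x) = letter j x"
  using assms by (auto simp: leg_def letter_eq fun_eq_iff intro!: arg_cong[where f = "\<lambda>w. Poly_Mapping.single w 1"])

lemma flip_letter: "flip i j (letter k x) = letter (Transposition.transpose i j k) x"
  by (auto simp: flip_def letter_eq fun_eq_iff Transposition.transpose_def intro!: arg_cong[where f = "\<lambda>w. Poly_Mapping.single w 1"])

lemma flip_leg:
  "flip s t (leg i j p) = leg (Transposition.transpose s t i) (Transposition.transpose s t j) p"
proof -
  have "(\<lambda>_. 0)(i := w 1, j := w 2) \<circ> Transposition.transpose s t =
    (\<lambda>_. 0)(Transposition.transpose s t i := w 1, Transposition.transpose s t j := w 2)"
    for w :: "2 \<Rightarrow> 'b free_word"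
    by (auto simp: fun_eq_iff Transposition.transpose_def)
  then show ?thesis
    by (simp add: flip_def leg_def lin_ext_comp)
qed

lemma leg_flip: "i \<noteq> j \<Longrightarrow> leg i j (flip 1 2 p) = leg j i p"
  by (simp add: flip_def leg_def lin_ext_comp fun_upd_twist)

lemma flip_flip [simp]: "flip i j (flip i j p) = p"
proof -
  have "flip i j (flip i j p) = lin_ext (\<lambda>w. w) p"
    by (simp add: flip_def lin_ext_comp comp_assoc)
  also have "\<dots> = p"
    using poly_mapping_sum_single[of p] by (simp add: lin_ext_def)
  finally show ?thesis .
qed

lemma flip_add: "flip i j (p + q) = flip i j p + flip i j q"
  and flip_diff: "flip i j (p - q) = flip i j p - flip i j q"
  and flip_uminus: "flip i j (- p) = - flip i j p"
  and flip_zero: "flip i j 0 = 0"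
  by (simp_all add: flip_def lin_ext_add lin_ext_minus lin_ext_uminus)

lemma flip_coproduct [simp]: "flip 1 2 (coproduct x) = coproduct x"
  by (simp add: coproduct_def flip_add flip_letter add.commute)

lemma flip_sum: "flip i j (sum f A) = (\<Sum>x\<in>A. flip i j (f x))"
  by (simp add: flip_def lin_ext_sum)

lemma legs_env_class:
  "i \<noteq> j \<Longrightarrow> lie_algebra L \<Longrightarrow> legs L i j (env_class L p) = env_class L (leg i j p)"
  unfolding legs_def leg_def by (rule word_hom_induced[OF word_leg])

lemma swap_env_class: "lie_algebra L \<Longrightarrow> swap L i j (env_class L p) = env_class L (flip i j p)"
  unfolding swap_def flip_def by (rule word_hom_induced[OF word_flip])

text \<open>The left side of the classical Yang--Baxter equation with three separate arguments: a
  component of the equation on the direct sum may involve three different r-matrices.\<close>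

definition yang_baxter ::
  "('k::field, 'g, 2) free_alg_pow \<Rightarrow> ('k, 'g, 2) free_alg_pow \<Rightarrow> ('k, 'g, 2) free_alg_pow \<Rightarrow>
   ('k, 'g, 3) free_alg_pow" where
  "yang_baxter p q s =
     comm (leg 1 2 p) (leg 1 3 q) + comm (leg 1 2 p) (leg 2 3 s) + comm (leg 1 3 q) (leg 2 3 s)"

definition invariant :: "('k::field, 'g::ab_group_add) lie \<Rightarrow> ('k, 'g, 2) free_alg_pow \<Rightarrow> bool" where
  "invariant L p \<longleftrightarrow> (\<forall>x. comm p (coproduct x) \<in> env_pow_ideal L)"

section \<open>Invariant tensors and the Yang--Baxter expression with mixed arguments\<close>

context
  fixes L :: "('k::field, 'g::ab_group_add) lie"
  assumes lie: "lie_algebra L"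
begin

lemma tensor_rep_flip: "tensor_rep L p \<Longrightarrow> tensor_rep L (flip 1 2 p)"
proof (rule tensor_rep_map[of "flip 1 2" L L])
  show "tensor_rep L (flip 1 2 (pure x y))" for x y
  proof -
    \<comment> \<open>The flip also reverses the order in which the two positions are multiplied;
      restoring it costs a commutator that is zero.\<close>
    have "flip 1 2 (pure x y) = (pure y x :: ('k, 'g, 2) free_alg_pow) - comm (letter 1 y) (letter 2 x)"
      by (simp add: flip_mult flip_letter comm_def)
    then show ?thesis
      by (simp add: comm_letter tensor_rep_pure)
  qed
qed (simp_all add: flip_add flip_ideal[OF lie])

lemma comm_leg_letter:
  assumes "tensor_rep L p" "i \<noteq> j" "k \<noteq> i" "k \<noteq> j"
  shows "comm (leg i j p) (letter k x) \<in> env_pow_ideal L"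
  using assms(1)
  by (rule tensor_rep_kernel[rotated -1])
    (use assms in \<open>simp_all add: leg_add comm_add_left comm_in_ideal_left leg_letter comm_letter
      leg_mult leg_ideal[OF _ lie] comm_mult_left\<close>)

lemma leg_comm_coproduct:
  assumes "i \<noteq> j"
  shows "leg i j (comm p (coproduct x)) = comm (leg i j p) (letter i x + letter j x)"
  using assms by (simp add: leg_comm leg_add coproduct_def leg_letter)

text \<open>For \<open>q = a \<otimes> b\<close> the second argument is \<open>\<Delta>(a)\<^sub>i\<^sub>j b\<^sub>k\<close>, so only the invariance of \<open>p\<close> is needed.\<close>

lemma comm_leg_invariant:
  assumes inv: "invariant L p" and p: "tensor_rep L p" and q: "tensor_rep L q"
    and ijk: "i \<noteq> j" "k \<noteq> i" "k \<noteq> j"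
  shows "comm (leg i j p) (leg i k q + leg j k q) \<in> env_pow_ideal L"
    and "comm (leg i j p) (leg k i q + leg k j q) \<in> env_pow_ideal L"
proof -
  note simps = leg_add leg_mult leg_ideal[OF _ lie]
    comm_add_right comm_in_ideal_right env_pow_ideal_add leg_letter
  have inv': "comm (leg i j p) (letter i x + letter j x) \<in> env_pow_ideal L" for x
    using inv leg_ideal[OF \<open>i \<noteq> j\<close> lie] by (simp add: invariant_def flip: leg_comm_coproduct[OF \<open>i \<noteq> j\<close>])
  have outer: "comm (leg i j p) (letter k y) \<in> env_pow_ideal L" for y
    by (rule comm_leg_letter[OF p]) (use ijk in auto)
  show "comm (leg i j p) (leg i k q + leg j k q) \<in> env_pow_ideal L"
  proof (rule tensor_rep_kernel[OF _ _ _ q])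
    fix x y
    have "comm (leg i j p) (leg i k (pure x y) + leg j k (pure x y)) =
      comm (leg i j p) ((letter i x + letter j x) * letter k y)"
      using ijk by (simp add: simps distrib_right)
    also have "\<dots> \<in> env_pow_ideal L"
      unfolding comm_mult_right
      by (intro env_pow_ideal_add env_pow_ideal_mult_left env_pow_ideal_mult_right outer inv')
    finally show "comm (leg i j p)
      (leg i k (pure x y) + leg j k (pure x y)) \<in> env_pow_ideal L" .
  qed (use ijk in \<open>simp_all add: simps\<close>)
  show "comm (leg i j p) (leg k i q + leg k j q) \<in> env_pow_ideal L"
  proof (rule tensor_rep_kernel[OF _ _ _ q])
    fix x y
    have "comm (leg i j p) (leg k i (pure x y) + leg k j (pure x y)) =
      comm (leg i j p) (letter k x * (letter i y + letter j y))"
      using ijk by (simp add: simps distrib_left)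
    also have "\<dots> \<in> env_pow_ideal L"
      unfolding comm_mult_right
      by (intro env_pow_ideal_add env_pow_ideal_mult_left env_pow_ideal_mult_right outer inv')
    finally show "comm (leg i j p)
      (leg k i (pure x y) + leg k j (pure x y)) \<in> env_pow_ideal L" .
  qed (use ijk in \<open>simp_all add: simps\<close>)
qed

text \<open>Replacing the first \<open>s\<close> by \<open>p\<close> adds the commutator of
  \<open>p - s\<close> in positions 1, 2 with \<open>s\<close> coproduced in its first factor, which
  vanishes by invariance.\<close>

lemma yang_baxter_right:
  assumes "tensor_rep L p" "tensor_rep L s" "invariant L (p - s)"
    and "yang_baxter s s s \<in> env_pow_ideal L"
  shows "yang_baxter p s s \<in> env_pow_ideal L"
proof -
  have "yang_baxter p s s = yang_baxter s s s + comm (leg 1 2 (p - s)) (leg 1 3 s + leg 2 3 s)"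
    by (simp add: yang_baxter_def leg_diff comm_def algebra_simps)
  also have "\<dots> \<in> env_pow_ideal L"
    by (intro env_pow_ideal_add comm_leg_invariant tensor_rep_diff assms) simp_all
  finally show ?thesis .
qed

text \<open>The mirror image of \<open>yang_baxter_right\<close>: the invariant now sits in
  positions 2, 3 and \<open>s\<close> is coproduced in its second factor.\<close>

lemma yang_baxter_left:
  assumes "tensor_rep L p" "tensor_rep L s" "invariant L (p - s)"
    and "yang_baxter s s s \<in> env_pow_ideal L"
  shows "yang_baxter s s p \<in> env_pow_ideal L"
proof -
  have "yang_baxter s s p = yang_baxter s s s - comm (leg 2 3 (p - s)) (leg 1 2 s + leg 1 3 s)"
    by (simp add: yang_baxter_def leg_diff comm_def algebra_simps)
  also have "\<dots> \<in> env_pow_ideal L"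
    by (intro env_pow_ideal_diff comm_leg_invariant tensor_rep_diff assms) simp_all
  finally show ?thesis .
qed

text \<open>Exchanging positions 2 and 3 turns the equation for \<open>s\<close> into minus the
  expression with arguments \<open>s\<close>, \<open>s\<close>, \<open>- flip 1 2 s\<close>. Passing
  to \<open>p\<close> in the middle changes it by a commutator with an invariant in positions 1,
  3.\<close>

lemma yang_baxter_middle:
  assumes "tensor_rep L p" "tensor_rep L s" "invariant L (p - s)"
    and "yang_baxter s s s \<in> env_pow_ideal L"
  shows "yang_baxter s p (- flip 1 2 s) \<in> env_pow_ideal L"
proof -
  have "yang_baxter s p (- flip 1 2 s) =
    - flip 2 3 (yang_baxter s s s) - comm (leg 1 3 (p - s)) (leg 1 2 s + leg 3 2 s)"
    by (simp add: yang_baxter_def leg_diff leg_uminus leg_flip flip_add flip_diff flip_mult flip_leg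
        Transposition.transpose_def comm_def algebra_simps)
  also have "\<dots> \<in> env_pow_ideal L"
    by (intro env_pow_ideal_diff env_pow_ideal_uminus flip_ideal comm_leg_invariant
        tensor_rep_diff assms lie) simp_all
  finally show ?thesis .
qed

text \<open>Exchanging positions 1 and 3 permutes the three brackets and reverses each of
  them.\<close>

lemma yang_baxter_uminus_flip:
  assumes "yang_baxter s s s \<in> env_pow_ideal L"
  shows "yang_baxter (- flip 1 2 s) (- flip 1 2 s) (- flip 1 2 s) \<in> env_pow_ideal L"
proof -
  have "yang_baxter (- flip 1 2 s) (- flip 1 2 s) (- flip 1 2 s) = - flip 1 3 (yang_baxter s s s)"
    by (simp add: yang_baxter_def leg_uminus leg_flip flip_add flip_diff flip_mult flip_leg
        Transposition.transpose_def comm_def algebra_simps)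
  then show ?thesis
    by (simp add: env_pow_ideal_uminus flip_ideal[OF lie assms])
qed

section \<open>Cobrackets that are coboundaries\<close>

lemma coproduct_add: "coproduct (x + y) - (coproduct x + coproduct y) \<in> env_pow_ideal L"
proof -
  have "coproduct (x + y) - (coproduct x + coproduct y) =
    (letter 1 (x + y) - letter 1 x - letter 1 y) +
    (letter 2 (x + y) - letter 2 x - letter 2 y :: ('k, 'g, 2) free_alg_pow)"
    by (simp add: coproduct_def)
  then show ?thesis
    by (simp add: env_pow_ideal_add letter_add)
qed

lemma coproduct_scl: "coproduct (scl L c x) - Poly_Mapping.single 0 c * coproduct x \<in> env_pow_ideal L"
proof -
  have "coproduct (scl L c x) - Poly_Mapping.single 0 c * coproduct x =
    (letter 1 (scl L c x) - Poly_Mapping.single 0 c * letter 1 x) +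
    (letter 2 (scl L c x) - Poly_Mapping.single 0 c * letter 2 x)"
    by (simp add: coproduct_def algebra_simps)
  then show ?thesis
    by (simp add: env_pow_ideal_add letter_scl)
qed

lemma coproduct_brk: "comm (coproduct x) (coproduct y) - coproduct (brk L x y) \<in> env_pow_ideal L"
proof -
  have "comm (coproduct x) (coproduct y) - coproduct (brk L x y) =
    (comm (letter 1 x) (letter 1 y) - letter 1 (brk L x y)) +
    (comm (letter 2 x) (letter 2 y) - letter 2 (brk L x y) :: ('k, 'g, 2) free_alg_pow)"
    by (simp add: coproduct_def comm_add_left comm_add_right comm_letter)
  then show ?thesis
    by (simp add: env_pow_ideal_add letter_brk)
qed

lemma comm_const: "comm p (Poly_Mapping.single 0 (c :: 'k) * q) = Poly_Mapping.single 0 c * comm p q"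
proof -
  have "p * Poly_Mapping.single 0 c = Poly_Mapping.single 0 c * p"
    by (induction p rule: poly_mapping_single_induct)
      (simp_all add: mult_single distrib_left distrib_right mult.commute)
  then have "comm p (Poly_Mapping.single 0 c) = 0"
    by (simp add: comm_def)
  then show ?thesis
    by (simp add: comm_mult_right)
qed

text \<open>The cyclic sum in the co-Jacobi identity is the commutator of the Yang--Baxter expression of \<open>\<rho>\<close>
  with \<open>x\<^sub>1 + x\<^sub>2 + x\<^sub>3\<close>, up to terms that vanish because \<open>\<rho> + \<tau>(\<rho>)\<close> is invariant.\<close>

lemma co_jacobi:
  fixes \<rho> :: "('k, 'g, 2) free_alg_pow" and x
  assumes \<rho>: "tensor_rep L \<rho>" and inv: "invariant L (\<rho> + flip 1 2 \<rho>)"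
    and yb: "yang_baxter \<rho> \<rho> \<rho> \<in> env_pow_ideal L"
  defines "X \<equiv> comm \<rho> (coproduct x)"
  shows "comm (leg 1 (2::3) \<rho>) (leg 1 3 X + leg 2 3 X) + comm (leg 2 3 \<rho>) (leg 2 1 X + leg 3 1 X)
    + comm (leg 3 1 \<rho>) (leg 3 2 X + leg 1 2 X) \<in> env_pow_ideal L"
proof -
  let ?D = "letter 1 x + letter 2 x + letter 3 x :: ('k, 'g, 3) free_alg_pow"
  have X: "tensor_rep L X"
    unfolding X_def by (rule tensor_rep_comm_coproduct[OF \<rho>])
  \<comment> \<open>The symmetric part of \<open>X\<close>; it lies in the ideal because
    \<open>\<rho> + flip 1 2 \<rho>\<close> is invariant.\<close>
  define n where "n i j = leg i j X + leg j i X" for i j :: 3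
  have n: "n i j \<in> env_pow_ideal L" if "i \<noteq> j" for i j
  proof -
    have "comm (\<rho> + flip 1 2 \<rho>) (coproduct x) = X + flip 1 2 X"
      by (simp add: X_def flip_comm comm_add_left)
    then have "X + flip 1 2 X \<in> env_pow_ideal L"
      using inv by (metis invariant_def)
    then have "leg i j (X + flip 1 2 X) \<in> env_pow_ideal L"
      by (rule leg_ideal[OF that lie])
    then show ?thesis
      using that by (simp add: n_def leg_add leg_flip)
  qed
  \<comment> \<open>The error made by bracketing with all three letters instead of those in
    positions \<open>i\<close> and \<open>j\<close>: the commutator with the remaining
    letter.\<close>
  define d where "d i j = comm (leg i j \<rho>) ?D - leg i j X" for i j :: 3
  have d: "d i j \<in> env_pow_ideal L" if ij: "i \<noteq> j" and "k \<noteq> i" "k \<noteq> j" "?D = letter i x + letter j x + letter k x" for i j k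
  proof -
    have "d i j = comm (leg i j \<rho>) (letter k x)"
      unfolding that d_def X_def leg_comm_coproduct[OF ij] by (simp add: comm_add_right)
    then show ?thesis
      using comm_leg_letter[OF \<rho> ij] that by simp
  qed
  have d': "d 1 2 \<in> env_pow_ideal L" "d 1 3 \<in> env_pow_ideal L" "d 2 3 \<in> env_pow_ideal L"
    by (rule d[of _ _ 3] d[of _ _ 2] d[of _ _ 1]; simp)+
  have m: "comm (leg 1 (3::3) (\<rho> + flip 1 2 \<rho>)) (leg 1 2 X + leg 3 2 X) \<in> env_pow_ideal L"
    by (rule comm_leg_invariant) (simp_all add: inv X \<rho> tensor_rep_add tensor_rep_flip)
  \<comment> \<open>Exact in the free algebra. The Leibniz rule expands the bracket with
    \<open>?D\<close>, the \<open>d\<close> terms reduce it to legs of \<open>X\<close>, the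
    \<open>n\<close> terms reverse legs of \<open>X\<close>, and the last term trades
    \<open>leg 3 1 \<rho>\<close> for \<open>- leg 1 3 \<rho>\<close>.\<close>
  have "comm (leg 1 2 \<rho>) (leg 1 3 X + leg 2 3 X) + comm (leg 2 3 \<rho>) (leg 2 1 X + leg 3 1 X)
      + comm (leg 3 1 \<rho>) (leg 3 2 X + leg 1 2 X) =
    comm (yang_baxter \<rho> \<rho> \<rho>) ?D
    - comm (leg 1 2 \<rho>) (d 1 3) - comm (d 1 2) (leg 1 3 \<rho>)
    - comm (leg 1 2 \<rho>) (d 2 3) - comm (d 1 2) (leg 2 3 \<rho>)
    - comm (leg 1 3 \<rho>) (d 2 3) - comm (d 1 3) (leg 2 3 \<rho>)
    + comm (leg 2 3 \<rho>) (n 1 2) + comm (leg 2 3 \<rho>) (n 1 3) - comm (leg 1 3 \<rho>) (n 2 3)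
    + comm (leg 1 3 (\<rho> + flip 1 2 \<rho>)) (leg 1 2 X + leg 3 2 X)"
    unfolding yang_baxter_def n_def d_def by (simp add: leg_add leg_flip comm_def algebra_simps)
  also have "\<dots> \<in> env_pow_ideal L"
    by (intro env_pow_ideal_add env_pow_ideal_diff comm_in_ideal_left comm_in_ideal_right d' n m yb)
      simp_all
  finally show ?thesis .
qed

text \<open>Since \<open>\<rho>\<close> in positions 1, 2 commutes with position 3,
  \<open>cobracket_id\<close> is the commutator of \<open>leg 1 2 \<rho>\<close> with the expansion
  coproduced in its first factor. This depends only on the class of the expansion, so any expansion
  leads to the cyclic sum of \<open>co_jacobi\<close>.\<close>

lemma co_jacobi_env:
  fixes \<rho> :: "('k, 'g, 2) free_alg_pow"
  assumes \<rho>: "tensor_rep L \<rho>" and inv: "invariant L (\<rho> + flip 1 2 \<rho>)"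
    and yb: "yang_baxter \<rho> \<rho> \<rho> \<in> env_pow_ideal L"
    and \<delta>: "\<And>x. \<delta> x = env_class L (comm \<rho> (coproduct x))"
    and x: "\<delta> x = lie_tensor L N a b"
  defines "u \<equiv> cobracket_id L \<delta> N a b"
  shows "u \<oplus>\<^bsub>env_pow L\<^esub> swap L 1 2 (swap L 2 3 u) \<oplus>\<^bsub>env_pow L\<^esub> swap L 2 3 (swap L 1 2 u)
    = \<zero>\<^bsub>env_pow L\<^esub>"
proof -
  define q :: "('k, 'g, 2) free_alg_pow" where "q = (\<Sum>t<N. pure (a t) (b t))"
  define X where "X = comm \<rho> (coproduct x)"
  define W :: "('k, 'g, 3) free_alg_pow" where "W = (\<Sum>t<N. leg 1 2 (comm \<rho> (coproduct (a t))) * letter 3 (b t))"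
  define V :: "('k, 'g, 3) free_alg_pow" where "V = comm (leg 1 2 \<rho>) (leg 1 3 X + leg 2 3 X)"
  have u: "u = env_class L W"
    by (simp add: u_def cobracket_id_def \<delta> legs_env_class lie elt_eq env_class_mult
        env_class_finsum W_def)
  have qX: "q - X \<in> env_pow_ideal L"
    using x by (simp add: \<delta> lie_tensor_eq q_def X_def flip: env_class_eq_iff)
  have "W - comm (leg 1 2 \<rho>) (leg 1 3 q + leg 2 3 q) =
    - (\<Sum>t<N. (letter 1 (a t) + letter 2 (a t)) * comm (leg 1 2 \<rho>) (letter 3 (b t)))"
  proof -
    have "leg 1 3 q + leg 2 3 q = (\<Sum>t<N. (letter 1 (a t) + letter 2 (a t)) * letter (3::3) (b t))"
      by (simp add: q_def leg_sum leg_mult leg_letter distrib_right sum.distrib)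
    then show ?thesis
      by (simp add: W_def leg_comm_coproduct comm_sum_right comm_mult_right sum.distrib)
  qed
  also have "\<dots> \<in> env_pow_ideal L"
    by (intro env_pow_ideal_uminus env_pow_ideal_sum env_pow_ideal_mult_left comm_leg_letter \<rho>)
      simp_all
  \<comment> \<open>The added term replaces the chosen expansion \<open>q\<close> by
    \<open>X\<close>.\<close>
  finally have "W - comm (leg 1 2 \<rho>) (leg 1 3 q + leg 2 3 q) +
    comm (leg 1 2 \<rho>) (leg 1 3 (q - X) + leg 2 3 (q - X)) \<in> env_pow_ideal L"
    by (intro env_pow_ideal_add comm_in_ideal_right leg_ideal[OF _ lie] qX) simp_all
  then have WV: "W - V \<in> env_pow_ideal L"
    by (simp add: V_def leg_diff comm_add_right comm_diff_right algebra_simps)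
  have "V + flip 1 2 (flip 2 3 V) + flip 2 3 (flip 1 2 V) \<in> env_pow_ideal L"
    using co_jacobi[OF \<rho> inv yb, of x]
    by (simp add: V_def X_def[symmetric] flip_comm flip_add flip_leg Transposition.transpose_def)
  moreover have "(W - V) + flip 1 2 (flip 2 3 (W - V)) + flip 2 3 (flip 1 2 (W - V)) \<in> env_pow_ideal L"
    by (intro env_pow_ideal_add flip_ideal[OF lie] WV)
  ultimately have "(W - V) + flip 1 2 (flip 2 3 (W - V)) + flip 2 3 (flip 1 2 (W - V))
    + (V + flip 1 2 (flip 2 3 V) + flip 2 3 (flip 1 2 V)) \<in> env_pow_ideal L"
    by (rule env_pow_ideal_add[rotated])
  then have "W + flip 1 2 (flip 2 3 W) + flip 2 3 (flip 1 2 W) \<in> env_pow_ideal L"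
    by (simp add: flip_diff algebra_simps)
  then show ?thesis
    by (simp add: u swap_env_class lie env_class_add env_class_zero env_class_eq_iff)
qed

text \<open>The cocycle identity is the Jacobi identity for commutators, antisymmetry is the
  invariance of the symmetric part of \<open>\<rho>\<close>, and co-Jacobi is
  \<open>co_jacobi_env\<close>.\<close>

lemma coboundary_lie_cobracket:
  fixes \<rho> :: "('k, 'g, 2) free_alg_pow"
  assumes \<rho>: "tensor_rep L \<rho>" and inv: "invariant L (\<rho> + flip 1 2 \<rho>)"
    and yb: "yang_baxter \<rho> \<rho> \<rho> \<in> env_pow_ideal L"
    and \<delta>: "\<And>x. \<delta> x = env_class L (comm \<rho> (coproduct x))"
  shows "lie_cobracket L \<delta>"
  unfolding lie_cobracket_def
proof (intro conjI allI impI)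
  show "\<delta> x \<in> lie_tensors L" for x
    by (simp add: \<delta> tensor_rep_iff tensor_rep_comm_coproduct[OF \<rho>])
  show "\<delta> (x + y) = \<delta> x \<oplus>\<^bsub>env_pow L\<^esub> \<delta> y" for x y
  proof -
    have "comm \<rho> (coproduct (x + y) - (coproduct x + coproduct y)) \<in> env_pow_ideal L"
      by (intro comm_in_ideal_right coproduct_add)
    then show ?thesis
      by (simp add: \<delta> env_class_add env_class_eq_iff comm_add_right comm_diff_right)
  qed
  show "\<delta> (scl L c x) = env_scale L c (\<delta> x)" for c x
  proof -
    have "comm \<rho> (coproduct (scl L c x) - Poly_Mapping.single 0 c * coproduct x) \<in> env_pow_ideal L"
      by (intro comm_in_ideal_right coproduct_scl)
    then show ?thesis
      by (simp add: \<delta> env_scale_def env_class_mult env_class_eq_iff comm_diff_right comm_const)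
  qed
  show "\<delta> (brk L x y) =
    commutator (env_pow L) (\<delta> x) (comult L y) \<ominus>\<^bsub>env_pow L\<^esub>
    commutator (env_pow L) (\<delta> y) (comult L x)" for x y
  proof -
    have "- comm \<rho> (comm (coproduct x) (coproduct y) - coproduct (brk L x y)) \<in> env_pow_ideal L"
      by (intro env_pow_ideal_uminus comm_in_ideal_right coproduct_brk)
    then show ?thesis
      by (simp add: \<delta> comult_eq env_class_commutator env_class_diff env_class_eq_iff)
        (simp add: comm_def algebra_simps)
  qed
  show "swap L 1 2 (\<delta> x) = \<ominus>\<^bsub>env_pow L\<^esub> \<delta> x" for x
    using inv
    by (simp add: \<delta> swap_env_class lie env_class_uminus env_class_eq_iff flip_comm
        invariant_def comm_add_left add.commute)
  show "let u = cobracket_id L \<delta> N a b in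
      u \<oplus>\<^bsub>env_pow L\<^esub> swap L 1 2 (swap L 2 3 u) \<oplus>\<^bsub>env_pow L\<^esub> swap L 2 3 (swap L 1 2 u)
        = \<zero>\<^bsub>env_pow L\<^esub>" if "\<delta> x = lie_tensor L N a b" for x N a b
    unfolding Let_def using co_jacobi_env[OF \<rho> inv yb \<delta> that] .
qed

end

section \<open>Direct sums of copies of a Lie algebra\<close>

lemma scl_lie_power [simp]: "scl (lie_power L) c x $ i = scl L c (x $ i)"
  and brk_lie_power [simp]: "brk (lie_power L) x y $ i = brk L (x $ i) (y $ i)"
  by (simp_all add: lie_power_def)

lemma brk_zero [simp]:
  assumes "lie_algebra L"
  shows "brk L 0 x = 0" "brk L x 0 = 0"
proof -
  have "brk L (0 + 0) x = brk L 0 x + brk L 0 x" "brk L x (0 + 0) = brk L x 0 + brk L x 0"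
    using assms unfolding lie_algebra_def Vector_Spaces.linear_iff by blast+
  then show "brk L 0 x = 0" "brk L x 0 = 0"
    by simp_all
qed

lemma scl_zero:
  assumes "lie_algebra L"
  shows "scl L c 0 = 0"
proof -
  have "scl L c (0 + 0) = scl L c 0 + scl L c 0"
    using assms unfolding lie_algebra_def vector_space_def by blast
  then show ?thesis
    by simp
qed

lemma lie_algebra_lie_power:
  assumes "lie_algebra L"
  shows "lie_algebra (lie_power L :: ('k::field, 'g::ab_group_add ^ 'n) lie)"
  using assms unfolding lie_algebra_def Vector_Spaces.linear_iff vector_space_def
  by (simp add: vec_eq_iff)

lemma lie_hom_axis:
  fixes a :: "'n::finite"
  assumes "lie_algebra L"
  shows "lie_hom L (lie_power L) (axis a)"
  using assms lie_algebra_lie_power[OF assms, where 'n = 'n]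
  unfolding lie_hom_def lie_algebra_def Vector_Spaces.linear_iff
  by (auto simp: vec_eq_iff axis_def brk_zero[OF assms] scl_zero[OF assms])

lemma lie_hom_diagonal:
  assumes "lie_algebra L"
  shows "lie_hom L (lie_power L) (\<lambda>x. \<chi> i :: 'n::finite. x)"
  using assms lie_algebra_lie_power[OF assms, where 'n = 'n]
  unfolding lie_hom_def lie_algebra_def Vector_Spaces.linear_iff
  by (auto simp: vec_eq_iff)

section \<open>Letterwise maps and placement in the copies of the Lie algebra\<close>

definition tensor ::
  "('m \<Rightarrow> 'g \<Rightarrow> 'h) \<Rightarrow> ('k::field, 'g, 'm) free_alg_pow \<Rightarrow> ('k, 'h, 'm) free_alg_pow" where
  "tensor \<phi> = lin_ext (\<lambda>w k. map_free_word (\<phi> k) (w k))"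

lemma map_free_word_plus: "map_free_word f (u + v) = map_free_word f u + map_free_word f v"
  by (cases u; cases v) (simp add: plus_free_word_def)

lemma map_free_word_zero [simp]: "map_free_word f 0 = 0"
  by (simp add: zero_free_word_def)

lemma tensor_word_add:
  "(\<lambda>k. map_free_word (\<phi> k) ((u + v) k)) =
    (\<lambda>k. map_free_word (\<phi> k) (u k)) + (\<lambda>k. map_free_word (\<phi> k) (v k))"
  by (simp add: fun_eq_iff map_free_word_plus)

lemma tensor_add: "tensor \<phi> (p + q) = tensor \<phi> p + tensor \<phi> q"
  and tensor_diff: "tensor \<phi> (p - q) = tensor \<phi> p - tensor \<phi> q"
  and tensor_uminus: "tensor \<phi> (- p) = - tensor \<phi> p"
  and tensor_zero: "tensor \<phi> 0 = 0"
  by (simp_all add: tensor_def lin_ext_add lin_ext_minus lin_ext_uminus)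

lemma tensor_mult: "tensor \<phi> (p * q) = tensor \<phi> p * tensor \<phi> q"
  unfolding tensor_def by (intro lin_ext_mult tensor_word_add)

lemma tensor_comm: "tensor \<phi> (comm p q) = comm (tensor \<phi> p) (tensor \<phi> q)"
  unfolding tensor_def by (intro lin_ext_comm tensor_word_add)

lemma tensor_letter: "tensor \<phi> (letter i x) = letter i (\<phi> i x)"
  by (auto simp: tensor_def letter_eq fun_eq_iff intro!: arg_cong[where f = "\<lambda>w. Poly_Mapping.single w 1"])

lemma word_tensor:
  "(\<And>k. lie_hom L L' (\<phi> k)) \<Longrightarrow> word_hom L L' (\<lambda>w k. map_free_word (\<phi> k) (w k)) (\<lambda>k. k) \<phi>"
  by (auto simp: word_hom_def fun_eq_iff map_free_word_plus)

lemma tensor_ideal: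
  "(\<And>k. lie_hom L L' (\<phi> k)) \<Longrightarrow> p \<in> env_pow_ideal L \<Longrightarrow> tensor \<phi> p \<in> env_pow_ideal L'"
  unfolding tensor_def by (rule word_hom_ideal[OF word_tensor])

lemma tensor_map_env_class:
  assumes "lie_hom L L' \<phi>" "lie_hom L L' \<psi>"
  shows "tensor_map L' \<phi> \<psi> (env_class L p) = env_class L' (tensor (\<lambda>k. if k = 1 then \<phi> else \<psi>) p)"
  unfolding tensor_map_def tensor_def by (rule word_hom_induced[OF word_tensor]) (simp add: assms)

abbreviation component ::
  "('m \<Rightarrow> 'n::finite) \<Rightarrow> ('k::field, 'g::zero, 'm) free_alg_pow \<Rightarrow> ('k, 'g ^ 'n, 'm) free_alg_pow" where
  "component f \<equiv> tensor (\<lambda>k. axis (f k))"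

abbreviation place_rep ::
  "'n::finite \<Rightarrow> 'n \<Rightarrow> ('k::field, 'g::zero, 2) free_alg_pow \<Rightarrow> ('k, 'g ^ 'n, 2) free_alg_pow" where
  "place_rep a b \<equiv> component (\<lambda>k. if k = 1 then a else b)"

lemma leg_place_rep:
  "leg i j (place_rep (f i) (f j) p) = component f (leg i j p)"
  unfolding leg_def tensor_def lin_ext_comp
  by (rule arg_cong[where f = "\<lambda>g. lin_ext g p"]) (simp add: fun_eq_iff)

lemma flip_place_rep: "flip 1 2 (place_rep a b p) = place_rep b a (flip 1 2 p)"
  unfolding flip_def tensor_def lin_ext_comp
  by (rule arg_cong[where f = "\<lambda>g. lin_ext g p"])
    (use exhaust_2 in \<open>force simp: fun_eq_iff Transposition.transpose_def\<close>)

text \<open>Makes the results on legs applicable to elements of the second tensor power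
  itself.\<close>

lemma leg_1_2 [simp]: "leg 1 2 p = p"
proof -
  have "leg 1 2 p = lin_ext (\<lambda>w. w) p"
    unfolding leg_def
    by (rule arg_cong[where f = "\<lambda>g. lin_ext g p"]) (use exhaust_2 in \<open>force simp: fun_eq_iff\<close>)
  also have "\<dots> = p"
    using poly_mapping_sum_single[of p] by (simp add: lin_ext_def)
  finally show ?thesis .
qed

text \<open>Identifies a matrix of elements of the second tensor power of the Lie algebra with one
  element for the direct sum.\<close>

definition assemble ::
  "('n::finite \<Rightarrow> 'n \<Rightarrow> ('k::field, 'g::zero, 2) free_alg_pow) \<Rightarrow> ('k, 'g ^ 'n, 2) free_alg_pow" where
  "assemble R = (\<Sum>a\<in>UNIV. \<Sum>b\<in>UNIV. place_rep a b (R a b))"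

context
  fixes L :: "('k::field, 'g::ab_group_add) lie"
    and L' :: "('k, 'g ^ 'n::finite) lie"
  assumes lie: "lie_algebra L"
  defines "L' \<equiv> lie_power L"
begin

lemma lie': "lie_algebra L'"
  unfolding L'_def by (rule lie_algebra_lie_power[OF lie])

lemma component_ideal: "p \<in> env_pow_ideal L \<Longrightarrow> component f p \<in> env_pow_ideal L'"
  unfolding L'_def by (rule tensor_ideal[OF lie_hom_axis[OF lie]])

lemma place_env_class: "place L a b (env_class L p) = env_class L' (place_rep a b p)"
  unfolding place_def L'_def
  by (simp add: tensor_map_env_class[OF lie_hom_axis[OF lie] lie_hom_axis[OF lie]] if_distrib)

text \<open>In one position, different copies have zero bracket, so they commute modulo the ideal;
  different positions commute exactly.\<close>

lemma comm_letter_axis: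
  assumes "i \<noteq> j \<or> z $ a = 0"
  shows "comm (letter i (axis a x)) (letter j z) \<in> env_pow_ideal L'"
proof (cases "i = j")
  case True
  then have "brk L' (axis a x) z = 0"
    using assms by (auto simp: L'_def vec_eq_iff axis_def lie)
  then have "comm (letter i (axis a x)) (letter i z) - letter i 0 + letter i 0 \<in> env_pow_ideal L'"
    using letter_brk[of i "axis a x" z L'] by (intro env_pow_ideal_add letter_zero) simp
  with True show ?thesis
    by simp
qed (simp add: comm_letter)

lemma tensor_rep_place:
  assumes "tensor_rep L p"
  shows "tensor_rep L' (place_rep a b p)"
  by (rule tensor_rep_map[of "place_rep a b", OF _ _ _ assms])
    (simp_all add: tensor_add component_ideal tensor_mult tensor_letter tensor_rep_pure)

lemma comm_leg_place_rep:
  assumes p: "tensor_rep L p" and "i \<noteq> j"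
    and "\<And>x. comm (letter i (axis a x)) z \<in> env_pow_ideal L'"
    and "\<And>x. comm (letter j (axis b x)) z \<in> env_pow_ideal L'"
  shows "comm (leg i j (place_rep a b p)) z \<in> env_pow_ideal L'"
  by (rule tensor_rep_kernel[where F = "\<lambda>p. comm (leg i j (place_rep a b p)) z", OF _ _ _ p])
    (use assms in \<open>simp_all add: tensor_add tensor_mult tensor_letter leg_add leg_mult leg_letter
      comm_add_left comm_mult_left comm_in_ideal_left leg_ideal lie' component_ideal
      env_pow_ideal_add env_pow_ideal_mult_left env_pow_ideal_mult_right\<close>)

text \<open>Placed tensors interact only through a shared position that carries the same copy in
  both. This removes the off-diagonal terms of the Yang--Baxter expression of
  \<open>assemble R\<close>.\<close>

lemma comm_leg_place_rep_disjoint: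
  assumes "tensor_rep L p" "tensor_rep L q" "i \<noteq> j" "k \<noteq> l"
    and disj: "i = k \<Longrightarrow> a \<noteq> a'" "i = l \<Longrightarrow> a \<noteq> b'" "j = k \<Longrightarrow> b \<noteq> a'" "j = l \<Longrightarrow> b \<noteq> b'"
  shows "comm (leg i j (place_rep a b p)) (leg k l (place_rep a' b' q)) \<in> env_pow_ideal L'"
proof (intro comm_leg_place_rep assms)
  have *: "comm (letter s (axis u x)) (leg k l (place_rep a' b' q)) \<in> env_pow_ideal L'"
    if "s = k \<Longrightarrow> u \<noteq> a'" "s = l \<Longrightarrow> u \<noteq> b'" for s u x
    unfolding comm_swap[of "letter s (axis u x)"]
    by (intro env_pow_ideal_uminus comm_leg_place_rep comm_letter_axis assms)
      (use that in \<open>auto simp: axis_def\<close>)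
  show "comm (letter i (axis a x)) (leg k l (place_rep a' b' q)) \<in> env_pow_ideal L'"
    "comm (letter j (axis b x)) (leg k l (place_rep a' b' q)) \<in> env_pow_ideal L'" for x
    using disj by (auto intro!: *)
qed

lemma comm_place_rep_letter:
  fixes a b :: 'n
  assumes p: "tensor_rep L p"
  defines "f \<equiv> \<lambda>k :: 2. if k = 1 then a else b"
  shows "comm (component f p) (letter i y) - component f (comm p (letter i (y $ f i))) \<in> env_pow_ideal L'"
proof -
  \<comment> \<open>The part of \<open>y\<close> outside the copy used in position \<open>i\<close>;
    it does not contribute to the commutator.\<close>
  define z where "z = y - axis (f i) (y $ f i)"
  have z: "z $ f i = 0"
    by (simp add: z_def axis_def)
  have "comm (leg 1 2 (place_rep a b p)) (letter i z) \<in> env_pow_ideal L'"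
    by (intro comm_leg_place_rep p comm_letter_axis) (use z in \<open>auto simp: f_def\<close>)
  then have "comm (component f p) (letter i (axis (f i) (y $ f i) + z) -
      letter i (axis (f i) (y $ f i)) - letter i z) + comm (component f p) (letter i z) \<in> env_pow_ideal L'"
    by (intro env_pow_ideal_add[OF comm_in_ideal_right[OF letter_add]]) (simp add: f_def)
  then show ?thesis
    by (simp add: z_def tensor_comm tensor_letter comm_diff_right)
qed

lemma comm_place_rep_coproduct:
  assumes p: "tensor_rep L p" and "y $ a = x" "y $ b = x"
  shows "comm (place_rep a b p) (coproduct y) - place_rep a b (comm p (coproduct x)) \<in> env_pow_ideal L'"
  using env_pow_ideal_add[OF comm_place_rep_letter[OF p, of a b 1 y] comm_place_rep_letter[OF p, of a b 2 y]]
    assms by (simp add: coproduct_def comm_add_right tensor_add algebra_simps)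

lemma tensor_rep_assemble: "(\<And>a b. tensor_rep L (R a b)) \<Longrightarrow> tensor_rep L' (assemble R)"
  unfolding assemble_def by (intro tensor_rep_sum tensor_rep_place)

text \<open>In the symmetric part the off-diagonal entries cancel exactly, and each diagonal entry
  is invariant within its own copy.\<close>

lemma invariant_assemble:
  assumes R: "\<And>a b. tensor_rep L (R a b)"
    and skew: "\<And>a b. a \<noteq> b \<Longrightarrow> R a b = - flip 1 2 (R b a)"
    and diag: "\<And>a. invariant L (R a a + flip 1 2 (R a a))"
  shows "invariant L' (assemble R + flip 1 2 (assemble R))"
  unfolding invariant_def
proof
  fix y
  have "flip 1 2 (assemble R) = (\<Sum>a\<in>UNIV. \<Sum>b\<in>UNIV. place_rep a b (flip 1 2 (R b a)))"
    unfolding assemble_def flip_sum flip_place_rep by (rule sum.swap)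
  then have "assemble R + flip 1 2 (assemble R) =
    (\<Sum>a\<in>UNIV. \<Sum>b\<in>UNIV. place_rep a b (R a b + flip 1 2 (R b a)))"
    by (simp add: assemble_def tensor_add sum.distrib)
  moreover have "comm (place_rep a b (R a b + flip 1 2 (R b a))) (coproduct y) \<in> env_pow_ideal L'" for a b
  proof (cases "a = b")
    case True
    let ?s = "R a a + flip 1 2 (R a a)"
    have "place_rep a a (comm ?s (coproduct (y $ a))) \<in> env_pow_ideal L'"
      using diag[of a] by (intro component_ideal) (simp add: invariant_def)
    moreover have "comm (place_rep a a ?s) (coproduct y) - place_rep a a (comm ?s (coproduct (y $ a)))
      \<in> env_pow_ideal L'"
      by (intro comm_place_rep_coproduct tensor_rep_add tensor_rep_flip[OF lie] R refl)
    ultimately show ?thesis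
      using True env_pow_ideal_add by fastforce
  next
    case False
    then show ?thesis
      using skew[OF False] by (simp add: tensor_zero)
  qed
  ultimately show "comm (assemble R + flip 1 2 (assemble R)) (coproduct y) \<in> env_pow_ideal L'"
    by (auto simp: comm_sum_left intro!: env_pow_ideal_sum)
qed

lemma sum_diagonal:
  fixes g :: "'n \<Rightarrow> 'n \<Rightarrow> ('k, 'g ^ 'n, 3) free_alg_pow"
  assumes "\<And>x y. x \<noteq> y \<Longrightarrow> g x y \<in> env_pow_ideal L'"
  shows "(\<Sum>x\<in>UNIV. \<Sum>y\<in>UNIV. g x y) - (\<Sum>x\<in>UNIV. g x x) \<in> env_pow_ideal L'"
proof -
  have "(\<Sum>y\<in>UNIV. g x y) = g x x + (\<Sum>y\<in>UNIV - {x}. g x y)" for x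
    by (rule sum.remove) auto
  then have "(\<Sum>x\<in>UNIV. \<Sum>y\<in>UNIV. g x y) - (\<Sum>x\<in>UNIV. g x x) = (\<Sum>x\<in>UNIV. \<Sum>y\<in>UNIV - {x}. g x y)"
    by (simp add: sum.distrib)
  also have "\<dots> \<in> env_pow_ideal L'"
    by (intro env_pow_ideal_sum assms) auto
  finally show ?thesis .
qed

lemma yang_baxter_assemble:
  assumes R: "\<And>a b. tensor_rep L (R a b)"
    and yb: "\<And>a b d. yang_baxter (R a b) (R a d) (R b d) \<in> env_pow_ideal L"
  shows "yang_baxter (assemble R) (assemble R) (assemble R) \<in> env_pow_ideal L'"
proof -
  let ?\<rho> = "assemble R"
  \<comment> \<open>The copies used in positions 1, 2, 3, so that all three brackets of one
    component are images under the same map.\<close>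
  define f :: "'n \<Rightarrow> 'n \<Rightarrow> 'n \<Rightarrow> 3 \<Rightarrow> 'n" where
    "f a b d k = (if k = 1 then a else if k = 2 then b else d)" for a b d k
  define P :: "3 \<Rightarrow> 3 \<Rightarrow> 'n \<Rightarrow> 'n \<Rightarrow> ('k, 'g ^ 'n, 3) free_alg_pow" where
    "P i j a b = leg i j (place_rep a b (R a b))" for i j a b
  have leg: "leg i j ?\<rho> = (\<Sum>a\<in>UNIV. \<Sum>b\<in>UNIV. P i j a b)" for i j
    by (simp add: assemble_def leg_sum P_def)
  have comm_leg: "comm (leg i j ?\<rho>) (leg k l ?\<rho>) =
    (\<Sum>a\<in>UNIV. \<Sum>b\<in>UNIV. \<Sum>a'\<in>UNIV. \<Sum>b'\<in>UNIV. comm (P i j a b) (P k l a' b'))" for i j k l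
    unfolding leg comm_sum_left unfolding comm_sum_right ..
  have component: "P i j (f a b d i) (f a b d j) = component (f a b d) (leg i j (R (f a b d i) (f a b d j)))"
    for i j a b d
    unfolding P_def by (rule leg_place_rep)
  \<comment> \<open>Position 1 is shared by both factors, so terms with distinct copies there lie in
    the ideal. The other two brackets share positions 2 and 3 and lose one summation index in the
    same way.\<close>
  have "(\<Sum>a\<in>UNIV. \<Sum>a'\<in>UNIV. \<Sum>b\<in>UNIV. \<Sum>d\<in>UNIV. comm (P 1 2 a b) (P 1 3 a' d)) -
      (\<Sum>a\<in>UNIV. \<Sum>b\<in>UNIV. \<Sum>d\<in>UNIV. comm (P 1 2 a b) (P 1 3 a d)) \<in> env_pow_ideal L'"
    unfolding P_def by (intro sum_diagonal env_pow_ideal_sum comm_leg_place_rep_disjoint R) auto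
  moreover have "comm (leg 1 2 ?\<rho>) (leg 1 3 ?\<rho>) =
    (\<Sum>a\<in>UNIV. \<Sum>a'\<in>UNIV. \<Sum>b\<in>UNIV. \<Sum>d\<in>UNIV. comm (P 1 2 a b) (P 1 3 a' d))"
    unfolding comm_leg by (rule sum.cong[OF refl], rule sum.swap)
  ultimately have 1: "comm (leg 1 2 ?\<rho>) (leg 1 3 ?\<rho>) -
    (\<Sum>a\<in>UNIV. \<Sum>b\<in>UNIV. \<Sum>d\<in>UNIV. comm (P 1 2 a b) (P 1 3 a d)) \<in> env_pow_ideal L'"
    by simp
  have "(\<Sum>a\<in>UNIV. ((\<Sum>b\<in>UNIV. \<Sum>b'\<in>UNIV. \<Sum>d\<in>UNIV. comm (P 1 2 a b) (P 2 3 b' d)) -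
      (\<Sum>b\<in>UNIV. \<Sum>d\<in>UNIV. comm (P 1 2 a b) (P 2 3 b d)))) \<in> env_pow_ideal L'"
    unfolding P_def by (intro sum_diagonal env_pow_ideal_sum comm_leg_place_rep_disjoint R) auto
  then have 2: "comm (leg 1 2 ?\<rho>) (leg 2 3 ?\<rho>) -
    (\<Sum>a\<in>UNIV. \<Sum>b\<in>UNIV. \<Sum>d\<in>UNIV. comm (P 1 2 a b) (P 2 3 b d)) \<in> env_pow_ideal L'"
    by (simp add: comm_leg sum_subtractf)
  have "(\<Sum>a\<in>UNIV. \<Sum>b\<in>UNIV. ((\<Sum>d\<in>UNIV. \<Sum>d'\<in>UNIV. comm (P 1 3 a d) (P 2 3 b d')) -
      (\<Sum>d\<in>UNIV. comm (P 1 3 a d) (P 2 3 b d)))) \<in> env_pow_ideal L'"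
    unfolding P_def by (intro sum_diagonal env_pow_ideal_sum comm_leg_place_rep_disjoint R) auto
  moreover have "comm (leg 1 3 ?\<rho>) (leg 2 3 ?\<rho>) =
    (\<Sum>a\<in>UNIV. \<Sum>b\<in>UNIV. \<Sum>d\<in>UNIV. \<Sum>d'\<in>UNIV. comm (P 1 3 a d) (P 2 3 b d'))"
    unfolding comm_leg by (rule sum.cong[OF refl], rule sum.swap)
  ultimately have 3: "comm (leg 1 3 ?\<rho>) (leg 2 3 ?\<rho>) -
    (\<Sum>a\<in>UNIV. \<Sum>b\<in>UNIV. \<Sum>d\<in>UNIV. comm (P 1 3 a d) (P 2 3 b d)) \<in> env_pow_ideal L'"
    by (simp add: sum_subtractf)
  have "comm (P 1 2 a b) (P 1 3 a d) + comm (P 1 2 a b) (P 2 3 b d) + comm (P 1 3 a d) (P 2 3 b d) =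
    component (f a b d) (yang_baxter (R a b) (R a d) (R b d))" for a b d
    using component[of 1 2 a b d] component[of 1 3 a b d] component[of 2 3 a b d]
    by (simp add: f_def yang_baxter_def tensor_add tensor_comm)
  then have "(\<Sum>a\<in>UNIV. \<Sum>b\<in>UNIV. \<Sum>d\<in>UNIV. comm (P 1 2 a b) (P 1 3 a d) +
      comm (P 1 2 a b) (P 2 3 b d) + comm (P 1 3 a d) (P 2 3 b d)) \<in> env_pow_ideal L'"
    by (intro env_pow_ideal_sum) (simp add: component_ideal yb)
  from env_pow_ideal_add[OF env_pow_ideal_add[OF env_pow_ideal_add[OF 1 2] 3] this]
  show ?thesis
    by (simp add: yang_baxter_def sum.distrib algebra_simps)
qed

text \<open>The diagonal vector is the sum of its \<open>axis\<close> components and letters are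
  additive modulo the ideal, so a pure tensor expands over all pairs of copies.\<close>

lemma diagonal_tensor_rep:
  assumes "tensor_rep L q"
  shows "tensor (\<lambda>_ x. \<chi> i. x) q - (\<Sum>a\<in>UNIV. \<Sum>b\<in>UNIV. place_rep a b q) \<in> env_pow_ideal L'"
proof (rule tensor_rep_kernel[where
      F = "\<lambda>q. tensor (\<lambda>_ x. \<chi> i. x) q - (\<Sum>a\<in>UNIV. \<Sum>b\<in>UNIV. place_rep a b q)", OF _ _ _ assms])
  fix x y :: 'g
  let ?D = "\<lambda>i x. letter i (\<chi> j. x) :: ('k, 'g ^ 'n, 2) free_alg_pow"
  let ?S = "\<lambda>i x. (\<Sum>a\<in>UNIV. letter i (axis a x)) :: ('k, 'g ^ 'n, 2) free_alg_pow"
  have D: "?D i x - ?S i x \<in> env_pow_ideal L'" for i x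
  proof -
    have "(\<chi> j. x) = (\<Sum>a\<in>UNIV. axis a x :: 'g ^ 'n)"
      by (simp add: vec_eq_iff axis_def)
    then show ?thesis
      by (simp add: letter_sum)
  qed
  have "tensor (\<lambda>_ x. \<chi> i. x) (pure x y) - (\<Sum>a\<in>UNIV. \<Sum>b\<in>UNIV. place_rep a b (pure x y)) =
    (?D 1 x - ?S 1 x) * ?D 2 y + ?S 1 x * (?D 2 y - ?S 2 y)"
    by (simp add: tensor_mult tensor_letter sum_product algebra_simps)
  also have "\<dots> \<in> env_pow_ideal L'"
    by (intro env_pow_ideal_add env_pow_ideal_mult_left env_pow_ideal_mult_right D)
  finally show "tensor (\<lambda>_ x. \<chi> i. x) (pure x y) - (\<Sum>a\<in>UNIV. \<Sum>b\<in>UNIV. place_rep a b (pure x y))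
    \<in> env_pow_ideal L'" .
next
  show "tensor (\<lambda>_ x. \<chi> i. x) p - (\<Sum>a\<in>UNIV. \<Sum>b\<in>UNIV. place_rep a b p) \<in> env_pow_ideal L'"
    if "p \<in> env_pow_ideal L" for p
  proof (intro env_pow_ideal_diff env_pow_ideal_sum component_ideal that)
    show "tensor (\<lambda>_ x. \<chi> i. x) p \<in> env_pow_ideal L'"
      unfolding L'_def by (rule tensor_ideal[OF lie_hom_diagonal[OF lie] that])
  qed
qed (simp add: tensor_add sum.distrib)

end

section \<open>Classical r-matrices\<close>

definition r_matrix_rep ::
  "('k::field, 'g::ab_group_add) lie \<Rightarrow> ('g \<Rightarrow> ('k, 'g, 2) env) \<Rightarrow> ('k, 'g, 2) free_alg_pow \<Rightarrow> bool"
  where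
  "r_matrix_rep L \<delta> s \<longleftrightarrow> tensor_rep L s \<and> yang_baxter s s s \<in> env_pow_ideal L \<and>
     (\<forall>x. \<delta> x = env_class L (comm s (coproduct x)))"

context
  fixes L :: "('k::field, 'g::ab_group_add) lie" and \<delta> :: "'g \<Rightarrow> ('k, 'g, 2) env"
  assumes lie: "lie_algebra L"
begin

lemma classical_r_matrixE:
  assumes "classical_r_matrix L \<delta> X"
  obtains s where "X = env_class L s" "r_matrix_rep L \<delta> s"
proof -
  have X: "X \<in> lie_tensors L"
    using assms by (simp add: classical_r_matrix_def)
  obtain s where s: "X = env_class L s" "tensor_rep L s"
    by (rule lie_tensorsE[OF X])
  show ?thesis
    using assms s
    by (intro that[of s]) (simp_all add: classical_r_matrix_def Let_def legs_env_class lie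
        env_class_commutator env_class_add env_class_zero env_class_eq_iff comult_eq
        yang_baxter_def r_matrix_rep_def)
qed

text \<open>Both have the same coboundary \<open>\<delta>\<close>.\<close>

lemma r_matrix_rep_diff: "r_matrix_rep L \<delta> p \<Longrightarrow> r_matrix_rep L \<delta> q \<Longrightarrow> invariant L (p - q)"
  by (auto simp: r_matrix_rep_def invariant_def comm_diff_left simp flip: env_class_eq_iff)

text \<open>The disjunction is what transitivity of the colouring provides for the entries at
  \<open>(a, b)\<close>, \<open>(a, d)\<close>, \<open>(b, d)\<close>; its cases are
  \<open>yang_baxter_right\<close>, \<open>yang_baxter_left\<close> and
  \<open>yang_baxter_middle\<close>.\<close>

lemma yang_baxter_r_matrix:
  assumes "r_matrix_rep L \<delta> p" "r_matrix_rep L \<delta> q" "r_matrix_rep L \<delta> s"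
    and "q = s \<or> p = q \<or> s = - flip 1 2 p"
  shows "yang_baxter p q s \<in> env_pow_ideal L"
proof -
  have rep: "tensor_rep L u" "yang_baxter u u u \<in> env_pow_ideal L" if "r_matrix_rep L \<delta> u" for u
    using that by (simp_all add: r_matrix_rep_def)
  from assms(4) show ?thesis
  proof (elim disjE)
    assume "q = s"
    then show ?thesis
      using yang_baxter_right[OF lie] rep r_matrix_rep_diff assms by blast
  next
    assume "p = q"
    then show ?thesis
      using yang_baxter_left[OF lie] rep r_matrix_rep_diff assms by blast
  next
    assume "s = - flip 1 2 p"
    then show ?thesis
      using yang_baxter_middle[OF lie] rep r_matrix_rep_diff assms by blast
  qed
qed

context
  assumes cobracket: "lie_cobracket L \<delta>"
begin

text \<open>Antisymmetry of \<open>\<delta>\<close>, rewritten as a statement about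
  \<open>s\<close>.\<close>

lemma invariant_r_matrix:
  assumes "r_matrix_rep L \<delta> s"
  shows "invariant L (s + flip 1 2 s)"
  unfolding invariant_def
proof
  fix x
  have "swap L 1 2 (\<delta> x) = \<ominus>\<^bsub>env_pow L\<^esub> \<delta> x"
    using cobracket by (simp add: lie_cobracket_def)
  moreover have "\<delta> x = env_class L (comm s (coproduct x))"
    using assms by (simp add: r_matrix_rep_def)
  ultimately show "comm (s + flip 1 2 s) (coproduct x) \<in> env_pow_ideal L"
    by (simp add: swap_env_class lie env_class_uminus env_class_eq_iff flip_comm comm_add_left
        add.commute)
qed

text \<open>Invariance of \<open>s + flip 1 2 s\<close> keeps the coboundary unchanged, and
  reversing the positions preserves the Yang--Baxter equation.\<close>

lemma r_matrix_rep_uminus_flip: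
  assumes "r_matrix_rep L \<delta> s"
  shows "r_matrix_rep L \<delta> (- flip 1 2 s)"
proof -
  have "env_class L (comm s (coproduct x)) = env_class L (comm (- flip 1 2 s) (coproduct x))" for x
    using invariant_r_matrix[OF assms]
    by (simp add: env_class_eq_iff invariant_def comm_add_left comm_uminus_left)
  then show ?thesis
    using assms yang_baxter_uminus_flip[OF lie] tensor_rep_uminus[OF tensor_rep_flip[OF lie]]
    by (simp add: r_matrix_rep_def)
qed

end

end

section \<open>The diagonal map into the twisted direct sum\<close>

theorem theorem4p10:
  fixes L :: "('k::field_char_0, 'g::ab_group_add) lie"
    and \<delta> :: "'g \<Rightarrow> ('k, 'g, 2) env"
    and C :: "'c set"
    and r :: "'c \<Rightarrow> ('k, 'g, 2) env"
    and c :: "'n::{finite,linorder} \<Rightarrow> 'n \<Rightarrow> 'c"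
  assumes "lie_bialgebra L \<delta>"
    and "quasi_triangular L \<delta>"
    and "\<And>a. a \<in> C \<Longrightarrow> classical_r_matrix L \<delta> (r a)"
    and "CARD('n) \<ge> 2"
    and "\<And>i j. i < j \<Longrightarrow> c i j \<in> C"
    and "transitive_colouring c"
  shows "lie_bialgebra_hom L \<delta>
           (lie_power L)
           (twisted_cobracket (lie_power L) (power_cobracket L \<delta>) (twist_element L r c))
           (\<lambda>x. \<chi> i. x)"
proof -
  let ?L' = "lie_power L :: ('k, ('g, 'n) vec) lie"
  define \<delta>' where "\<delta>' = twisted_cobracket ?L' (power_cobracket L \<delta>) (twist_element L r c)"
  have lie: "lie_algebra L" and cobracket: "lie_cobracket L \<delta>"
    using assms(1) by (simp_all add: lie_bialgebra_def)
  have lie': "lie_algebra ?L'"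
    by (rule lie_algebra_lie_power[OF lie])
  note [simp] = swap_env_class[OF lie'] place_env_class[OF lie]
  obtain p where p: "r_matrix_rep L \<delta> p"
    using assms(2) classical_r_matrixE[OF lie] unfolding quasi_triangular_def by metis
  have "\<forall>a\<in>C. \<exists>s. r a = env_class L s \<and> r_matrix_rep L \<delta> s"
    using assms(3) classical_r_matrixE[OF lie] by metis
  then obtain s where s: "\<And>a. a \<in> C \<Longrightarrow> r a = env_class L (s a)"
    "\<And>a. a \<in> C \<Longrightarrow> r_matrix_rep L \<delta> (s a)"
    by metis
  \<comment> \<open>The entries below the diagonal come from the twist element, those above from
    minus its flip. The diagonal entry \<open>p\<close>, supplied by quasi-triangularity, produces
    the untwisted cobracket.\<close>
  define R where "R a b = (if a = b then p else if b < a then s (c b a) else - flip 1 2 (s (c a b)))"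
    for a b
  have R: "r_matrix_rep L \<delta> (R a b)" for a b
    using p s(2) assms(5) r_matrix_rep_uminus_flip[OF lie cobracket]
    by (auto simp: R_def)
  then have R_tensor: "tensor_rep L (R a b)"
    and R_\<delta>: "\<delta> x = env_class L (comm (R a b) (coproduct x))" for a b x
    by (auto simp: r_matrix_rep_def)
  have skew: "R a b = - flip 1 2 (R b a)" if "a \<noteq> b" for a b
    using that by (auto simp: R_def flip_uminus)
  have "R a d = R b d \<or> R a b = R a d \<or> R b d = - flip 1 2 (R a b)" for a b d
  proof -
    have col: "c i k = c i j \<or> c i k = c j k" if "i < j" "j < k" for i j k
      using assms(6) that unfolding transitive_colouring_def by blast
    show ?thesis
    proof (cases "a = b \<or> b = d \<or> a = d")
      \<comment> \<open>Coinciding indices need no colouring: \<open>a = b\<close> and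
        \<open>b = d\<close> give the first two alternatives, and \<open>a = d\<close> gives the
        third by \<open>skew\<close>.\<close>
      case True
      then show ?thesis
        using skew by metis
    next
      case False
      \<comment> \<open>For each order, transitivity equates the colour of the outer pair with that
        of one of the two inner pairs, and either equality yields one of the alternatives.\<close>
      then consider "a < b" "b < d" | "a < d" "d < b" | "b < a" "a < d" | "b < d" "d < a"
        | "d < a" "a < b" | "d < b" "b < a"
        by (metis linorder_less_linear)
      then show ?thesis
        by cases (use col[of a b d] col[of a d b] col[of b a d] col[of b d a] col[of d a b]
            col[of d b a] in \<open>auto simp: R_def flip_uminus\<close>)
    qed
  qed
  then have yb: "yang_baxter (assemble R) (assemble R) (assemble R) \<in> env_pow_ideal ?L'"
    by (intro yang_baxter_assemble[OF lie] R_tensor yang_baxter_r_matrix[OF lie R R R])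
  have inv: "invariant ?L' (assemble R + flip 1 2 (assemble R))"
    by (intro invariant_assemble[OF lie] R_tensor skew invariant_r_matrix[OF lie cobracket R])
  define J where "J = (\<Sum>(i, j)\<in>{(i, j). i < j}. place_rep j i (s (c i j)) :: ('k, ('g, 'n) vec, 2) free_alg_pow)"
  \<comment> \<open>The default 0 extends the sum to all pairs, so that it can be compared with
    \<open>assemble R\<close> entry by entry.\<close>
  have J: "J = (\<Sum>i\<in>UNIV. \<Sum>j\<in>UNIV. if i < j then place_rep j i (s (c i j)) else 0)"
  proof -
    have "J = (\<Sum>q\<in>UNIV. case q of (i, j) \<Rightarrow> if i < j then place_rep j i (s (c i j)) else 0)"
      unfolding J_def by (rule sum.mono_neutral_cong_left) (auto split: if_splits)
    then show ?thesis
      by (simp add: sum.cartesian_product UNIV_Times_UNIV)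
  qed
  have twist: "twist_element L r c = env_class ?L' J"
  proof -
    interpret ring "env_pow ?L' :: ('k, ('g, 'n) vec, 2) env ring"
      by (rule ring_env_pow)
    have "twist_element L r c =
      (\<Oplus>\<^bsub>env_pow ?L'\<^esub> q\<in>{(i, j). i < j}. env_class ?L' (case q of (i, j) \<Rightarrow> place_rep j i (s (c i j))))"
      unfolding twist_element_def
      by (rule finsum_cong') (auto simp: s(1) assms(5))
    then show ?thesis
      by (simp add: env_class_finsum J_def)
  qed
  have rho: "assemble R = (\<Sum>i\<in>UNIV. place_rep i i p) + (J - flip 1 2 J)"
  proof -
    have "place_rep a b (R a b) = (if a = b then place_rep a a p else 0) +
      ((if b < a then place_rep a b (s (c b a)) else 0) -
       (if a < b then place_rep a b (flip 1 2 (s (c a b))) else 0))" for a b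
      by (auto simp: R_def tensor_uminus)
    moreover have "flip 1 2 J =
      (\<Sum>a\<in>UNIV. \<Sum>b\<in>UNIV. if a < b then place_rep a b (flip 1 2 (s (c a b))) else 0)"
      unfolding J flip_sum
      by (intro sum.cong refl) (simp add: flip_place_rep flip_zero if_distrib[of "flip 1 2"])
    moreover have "J = (\<Sum>a\<in>UNIV. \<Sum>b\<in>UNIV. if b < a then place_rep a b (s (c b a)) else 0)"
      unfolding J by (rule sum.swap)
    ultimately show ?thesis
      by (simp add: assemble_def sum.distrib sum_subtractf)
  qed
  \<comment> \<open>By \<open>rho\<close>, the diagonal entries account for
    \<open>power_cobracket\<close> and \<open>J - flip 1 2 J\<close> for the twist.\<close>
  have \<delta>': "\<delta>' y = env_class ?L' (comm (assemble R) (coproduct y))" for y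
  proof -
    have "(\<Sum>i\<in>UNIV. comm (place_rep i i p) (coproduct y) - place_rep i i (comm p (coproduct (y $ i))))
      \<in> env_pow_ideal ?L'"
      using p by (intro env_pow_ideal_sum comm_place_rep_coproduct[OF lie])
        (simp_all add: r_matrix_rep_def)
    then have "comm (assemble R) (coproduct y) -
      ((\<Sum>i\<in>UNIV. place_rep i i (comm p (coproduct (y $ i)))) + comm (J - flip 1 2 J) (coproduct y))
      \<in> env_pow_ideal ?L'"
      by (simp add: rho comm_add_left comm_sum_left sum_subtractf)
    moreover have "power_cobracket L \<delta> y =
      env_class ?L' (\<Sum>i\<in>UNIV. place_rep i i (comm p (coproduct (y $ i))))"
      using p by (simp add: power_cobracket_def r_matrix_rep_def env_class_finsum)
    ultimately show ?thesis
      by (simp add: \<delta>'_def twisted_cobracket_def twist comult_eq env_class_diff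
          env_class_commutator env_class_add env_class_eq_iff[symmetric])
  qed
  have "\<delta>' (\<chi> i. x) = tensor_map ?L' (\<lambda>x. \<chi> i. x) (\<lambda>x. \<chi> i. x) (\<delta> x)" for x
  proof -
    let ?diag = "tensor (\<lambda>_ x. \<chi> i. x) :: ('k, 'g, 2) free_alg_pow \<Rightarrow> ('k, ('g, 'n) vec, 2) free_alg_pow"
    let ?d = "comm p (coproduct x)"
    \<comment> \<open>Every \<open>R a b\<close> induces the same \<open>\<delta>\<close>, so on a
      diagonal element each component may be replaced by \<open>?d\<close>, whatever the
      colours.\<close>
    have "place_rep a b (comm (R a b) (coproduct x) - ?d) \<in> env_pow_ideal ?L'" for a b
      using R_\<delta>[of x a b] p
      by (intro component_ideal[OF lie]) (simp add: r_matrix_rep_def flip: env_class_eq_iff)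
    then have "(\<Sum>a\<in>UNIV. \<Sum>b\<in>UNIV. (comm (place_rep a b (R a b)) (coproduct (\<chi> i. x)) -
      place_rep a b (comm (R a b) (coproduct x))) + place_rep a b (comm (R a b) (coproduct x) - ?d))
      \<in> env_pow_ideal ?L'"
      by (intro env_pow_ideal_sum env_pow_ideal_add comm_place_rep_coproduct[OF lie] R_tensor) simp_all
    then have "comm (assemble R) (coproduct (\<chi> i. x)) - (\<Sum>a\<in>UNIV. \<Sum>b\<in>UNIV. place_rep a b ?d)
      \<in> env_pow_ideal ?L'"
      by (simp add: assemble_def comm_sum_left sum_subtractf tensor_diff)
    moreover have "?diag ?d - (\<Sum>a\<in>UNIV. \<Sum>b\<in>UNIV. place_rep a b ?d) \<in> env_pow_ideal ?L'"
      using p by (intro diagonal_tensor_rep[OF lie] tensor_rep_comm_coproduct)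
        (simp add: r_matrix_rep_def)
    ultimately have "comm (assemble R) (coproduct (\<chi> i. x)) - ?diag ?d \<in> env_pow_ideal ?L'"
      using env_pow_ideal_diff by fastforce
    moreover have "\<delta> x = env_class L ?d"
      using p by (simp add: r_matrix_rep_def)
    ultimately show ?thesis
      by (simp add: \<delta>' tensor_map_env_class[OF lie_hom_diagonal[OF lie] lie_hom_diagonal[OF lie]]
          env_class_eq_iff)
  qed
  moreover have "lie_cobracket ?L' \<delta>'"
    by (rule coboundary_lie_cobracket[OF lie' _ inv yb \<delta>'])
      (rule tensor_rep_assemble[OF lie R_tensor])
  ultimately show ?thesis
    using assms(1) lie' lie_hom_diagonal[OF lie]
    by (simp add: lie_bialgebra_hom_def lie_bialgebra_def \<delta>'_def)
qed

end
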